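(* For the chain with periodic boundary conditions and $N$ sites, with Hamiltonian $H = \sum_{j=1}^N [1-\sigma^z_j \sigma^z_{j+1} - \epsilon \sigma^x_j \sigma^x_{j+1} - \epsilon \sigma^y_j \sigma^y_{j+1}]$ (indices periodic), we consider the sector with $m$ down spins ($0<m<N$). There is a constant $K>0$ (independent of $N$) such that if $K |\epsilon|<1$, then the fixed point equation (described in the context) has a solution in the norm $$||e|| = \sum_{n=1}^N |e_n| (K |\epsilon|)^{-w_n} + 2 \sum_{X:m} |e(X)| (n(X)-2) (K |\epsilon|)^{-w(X)}.$$ The $N$ eigenstates and eigenvalues determined by this solution through $$\Psi_k = \sum_{l=1}^N e^{ikl} \sum_{X:m} e(X) \, |(X \Delta M)+l\rangle, \qquad E(k) = 2 + \sum_{s=1}^N e_s e^{iks}$$ have the lowest eigenvalues in this sector. (Except for $k=0$ in which case it is the second lowest.) Letting $E_N(k)$ denote the eigenvalue for a chain with $N$ sites corresponding to momentum $k$, there are constants $d_s$ for $s \in \mathbf{Z}$ such that $$\lim_{N \rightarrow \infty} E_N(k) = 2 + \sum_{s=-\infty}^{\infty} d_s e^{iks}.$$ The Fourier coefficients $d_s$ are absolutely summable, and for $s \ne 0$ the coefficients are of order at most $\epsilon^m$.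
   Context: Notation: $M=\{1,2,\dots,m\}$. For a set $X$ of sites, $|X\rangle$ is the state with down spins at sites in $X$ and up spins elsewhere; $X \Delta Y$ is the symmetric difference; $Y+l=\{i+l: i\in Y\}$ (periodic). $X:m$ means $X\Delta M$ has $m$ elements. $\partial(Y)$ is the set of bonds $\langle j,j+1\rangle$ with exactly one endpoint in $Y$, and $n(X)$ is the number of bonds in $\partial(X\Delta M)$ (so $2n(X)$ is the $\epsilon=0$ eigenvalue of $|X\Delta M\rangle$). $\Psi_k$ satisfies $T\Psi_k=e^{-ik}\Psi_k$ with $T$ translation by one site to the right. The unknowns are $e_n$ ($n=1,\dots,N$) and $e(X)$ for $X:m$ with $n(X)>2$; one sets $e(\emptyset)=1$ and $e(M\Delta(M+n))=0$ for $n\neq 0$ (these are the other $X$ with $n(X)=2$). The fixed point equation $F(e)=e$ is $$e_n = 2\epsilon \sum_{\langle j,j+1\rangle \in \partial(M-n)} e(M\Delta(M-n)\Delta\{j,j+1\}),$$ and, for $X:m$ with $n(X)>2$, $$e(X) = -\frac{\epsilon}{n(X)-2}\sum_{\langle j,j+1\rangle\in\partial(X\Delta M)} e(X\Delta\{j,j+1\}) + \frac12\,\frac{1}{n(X)-2}\sum_{s=1}^N e_s\, e((X+s)\Delta(M+s)\Delta M).$$ In the norm, $w(X)$ is the smallest $n$ such that there is a sequence $X_0=\emptyset, X_1,\dots,X_n=X$ with $X_i = X_{i-1}\Delta\{j,j+1\}$ for some bond $\langle j,j+1\rangle\in\partial(X_{i-1}\Delta M)$ (the lowest order in perturbation theory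 at which $e(X)$ is nonzero), and $w_n = w(M\Delta(M+n))$. For finite $N$, $E_N(k)$ is extended to all $k$ via the Fourier series for $E(k)$ above.
   Formalization: Corrected: the states are eigenstates of H with ε replaced by −ε; E(k) and its limit have constant 4, not 2; the false remark that k=0 is second lowest is dropped; for general k, E_N(k) uses exponents s taken mod N in (−N/2, N/2]. *)

theory Defs
  imports "HOL-Analysis.Analysis"
begin

text \<open>Periodic chain with sites 0,...,N-1 (the paper's sites 1..N relabelled i -> i-1).
  A basis state |Y> (down spins exactly at the sites in Y) is identified with the subset Y;
  a vector in the Hilbert space is a function from subsets of sites to complex amplitudes.\<close>

definition symd :: "nat set \<Rightarrow> nat set \<Rightarrow> nat set" where
  "symd A B = (A - B) \<union> (B - A)"

definition shift :: "nat \<Rightarrow> nat set \<Rightarrow> int \<Rightarrow> nat set" where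
  "shift N Y l = (\<lambda>i. nat ((int i + l) mod int N)) ` Y"

definition Mset :: "nat \<Rightarrow> nat set" where
  "Mset m = {0..<m}"

definition bond :: "nat \<Rightarrow> nat \<Rightarrow> nat set" where
  "bond N j = {j, Suc j mod N}"

definition bdry :: "nat \<Rightarrow> nat set \<Rightarrow> nat set" where
  "bdry N Y = {j \<in> {0..<N}. (j \<in> Y) \<noteq> (Suc j mod N \<in> Y)}"

definition Xset :: "nat \<Rightarrow> nat \<Rightarrow> nat set set" where
  "Xset N m = {X. X \<subseteq> {0..<N} \<and> card (symd X (Mset m)) = m}"

definition nX :: "nat \<Rightarrow> nat \<Rightarrow> nat set \<Rightarrow> nat" where
  "nX N m X = card (bdry N (symd X (Mset m)))"

inductive reach :: "nat \<Rightarrow> nat \<Rightarrow> nat \<Rightarrow> nat set \<Rightarrow> bool" for N m where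
  reach0: "reach N m 0 {}"
| reachS: "reach N m n X \<Longrightarrow> j \<in> bdry N (symd X (Mset m)) \<Longrightarrow>
           reach N m (Suc n) (symd X (bond N j))"

definition wX :: "nat \<Rightarrow> nat \<Rightarrow> nat set \<Rightarrow> nat" where
  "wX N m X = (LEAST n. reach N m n X)"

definition wn :: "nat \<Rightarrow> nat \<Rightarrow> nat \<Rightarrow> nat" where
  "wn N m n = wX N m (symd (Mset m) (shift N (Mset m) (int n)))"

text \<open>The fixed point equation F(e) = e, with the normalisations e(empty) = 1 and
  e(M Delta (M+n)) = 0 for n not 0 (mod N).  es n is e_n (n = 1..N), e X is e(X).\<close>
definition is_fp :: "nat \<Rightarrow> nat \<Rightarrow> real \<Rightarrow> (nat \<Rightarrow> real) \<Rightarrow> (nat set \<Rightarrow> real) \<Rightarrow> bool" where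
  "is_fp N m \<epsilon> es e \<longleftrightarrow>
     e {} = 1
   \<and> (\<forall>n\<in>{1..<N}. e (symd (Mset m) (shift N (Mset m) (int n))) = 0)
   \<and> (\<forall>n\<in>{1..N}. es n = 2 * \<epsilon> *
        (\<Sum>j\<in>bdry N (shift N (Mset m) (- int n)).
            e (symd (symd (Mset m) (shift N (Mset m) (- int n))) (bond N j))))
   \<and> (\<forall>X\<in>Xset N m. nX N m X > 2 \<longrightarrow>
        e X = - \<epsilon> / (real (nX N m X) - 2) *
                (\<Sum>j\<in>bdry N (symd X (Mset m)). e (symd X (bond N j)))
              + 1/2 * (1 / (real (nX N m X) - 2)) *
                (\<Sum>s=1..N. es s *
                   e (symd (symd (shift N X (int s)) (shift N (Mset m) (int s))) (Mset m))))"

definition fp_norm :: "nat \<Rightarrow> nat \<Rightarrow> real \<Rightarrow> real \<Rightarrow> (nat \<Rightarrow> real) \<Rightarrow> (nat set \<Rightarrow> real) \<Rightarrow> real" where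
  "fp_norm N m K \<epsilon> es e =
     (\<Sum>n=1..N. \<bar>es n\<bar> * inverse ((K * \<bar>\<epsilon>\<bar>) ^ wn N m n))
   + 2 * (\<Sum>X\<in>Xset N m. \<bar>e X\<bar> * (real (nX N m X) - 2) * inverse ((K * \<bar>\<epsilon>\<bar>) ^ wX N m X))"

text \<open>The Hamiltonian H = sum_j [1 - sz_j sz_{j+1} - eps sx_j sx_{j+1} - eps sy_j sy_{j+1}]
  written through its matrix elements:
  H|Y> = 2 |bdry Y| |Y> - 2 eps sum_{b in bdry Y} |Y Delta b>.\<close>
definition ham :: "nat \<Rightarrow> real \<Rightarrow> (nat set \<Rightarrow> complex) \<Rightarrow> (nat set \<Rightarrow> complex)" where
  "ham N \<epsilon> f = (\<lambda>Y. if Y \<subseteq> {0..<N} then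
        2 * of_nat (card (bdry N Y)) * f Y
      - 2 * of_real \<epsilon> * (\<Sum>j\<in>bdry N Y. f (symd Y (bond N j)))
     else 0)"

text \<open>Translation T by one site to the right: T|Y> = |Y+1>.\<close>
definition transl :: "nat \<Rightarrow> (nat set \<Rightarrow> complex) \<Rightarrow> (nat set \<Rightarrow> complex)" where
  "transl N f = (\<lambda>Y. if Y \<subseteq> {0..<N} then f (shift N Y (-1)) else 0)"

definition in_sector :: "nat \<Rightarrow> nat \<Rightarrow> (nat set \<Rightarrow> complex) \<Rightarrow> bool" where
  "in_sector N m f \<longleftrightarrow> (\<forall>Y. f Y \<noteq> 0 \<longrightarrow> Y \<subseteq> {0..<N} \<and> card Y = m)"

definition psi :: "nat \<Rightarrow> nat \<Rightarrow> (nat set \<Rightarrow> real) \<Rightarrow> real \<Rightarrow> (nat set \<Rightarrow> complex)" where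
  "psi N m e k = (\<lambda>Y. \<Sum>l=1..N. \<Sum>X\<in>Xset N m.
      if shift N (symd X (Mset m)) (int l) = Y
      then exp (\<i> * of_real k * of_nat l) * of_real (e X) else 0)"

text \<open>Representative of s mod N in (-N/2, N/2], used to extend E_N(k) to all real k.\<close>
definition rep :: "nat \<Rightarrow> nat \<Rightarrow> int" where
  "rep N s = (if 2 * s \<le> N then int s else int s - int N)"

definition EN :: "nat \<Rightarrow> (nat \<Rightarrow> real) \<Rightarrow> real \<Rightarrow> complex" where
  "EN N es k = 4 + (\<Sum>s=1..N. of_real (es s) * exp (\<i> * of_real k * of_int (rep N s)))"

end

theory Submission
  imports Defs
begin

text \<open>Write a configuration as \<open>Y = X \<Delta> M\<close> and \<open>f Y = e (X)\<close>. A move changes the distance of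
  \<open>Y\<close> from \<open>M\<close> by at most one, so the factor \<open>\<epsilon>\<close> of a hop costs only \<open>|\<epsilon>| / k = 1 / K\<close> in the
  weighted norm with \<open>k = K |\<epsilon>|\<close>, and the distance is subadditive under translations, so the
  quadratic term is bounded by the product of the norms. Hence the fixed point map is a
  contraction of the unit ball, uniformly in \<open>N\<close>.

  A vector orthogonal to all \<open>\<Psi>\<^sub>k\<close> satisfies \<open>\<Sum>\<^sub>Y f Y v (Y + l) = 0\<close> for every \<open>l\<close>; since \<open>f M = 1\<close> and
  the remaining coefficients sum to at most one half, \<open>|v|\<close> is maximal at a configuration with more
  boundary bonds than \<open>M\<close>, and the eigenvalue equation at that configuration gives the gap.

  For the limit, each iterate of the contraction, evaluated at a configuration of \<open>\<int>\<close> wrapped around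
  the ring, converges as \<open>N \<rightarrow> \<infinity>\<close> by dominated convergence, because \<open>e\<^sub>s\<close> decays like \<open>k\<close> to the
  power \<open>|s|\<close>. The iterates approach the fixed point at a rate independent of \<open>N\<close>.\<close>

section \<open>Translations and moves on the ring\<close>

text \<open>The constants answer two separate demands. The contraction needs 12, so that
  \<open>2 * \<bar>\<epsilon>\<bar> / k \<le> 1/6\<close>, which leaves room for the quadratic term
  inside the unit ball. The separation of the spectrum needs \<open>4 * m\<close>: a configuration
  has at most \<open>2 * m\<close> boundary bonds, however long the ring, so hopping moves a maximal
  amplitude by at most a fraction \<open>4 * m * \<bar>\<epsilon>\<bar>\<close> of itself. The two
  energy estimates then meet at 5: the band stays within distance 1 of 4, and an eigenvalue with
  eigenvector orthogonal to the band lies within distance 1 of some \<open>2 * n\<close> with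
  \<open>n \<ge> 3\<close>. The limit is asserted for every family of fixed points in the unit ball,
  so uniqueness of the \<open>E\<close> part is needed besides existence; both come from the same
  iteration. The iteration also supplies the induction along which convergence in \<open>N\<close>
  is proved: one step consists of a hop sum and a convolution, and each of these preserves
  convergence. The fixed point by itself offers no such induction.\<close>

lemma symd_iff: "x \<in> symd A B \<longleftrightarrow> (x \<in> A) \<noteq> (x \<in> B)"
  by (auto simp: symd_def)

lemma symd_commute: "symd A B = symd B A"
  by (auto simp: symd_def)

lemma symd_cancel [simp]: "symd (symd A B) B = A"
  by (auto simp: symd_def)

lemma symd_right_commute: "symd (symd A B) C = symd (symd A C) B"
  by (auto simp: symd_def)

lemma symd_self [simp]: "symd A A = {}"
  by (auto simp: symd_def)

lemma symd_empty [simp]: "symd {} A = A" "symd A {} = A"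
  by (auto simp: symd_def)

lemma symd_image:
  assumes "inj_on f S" "A \<subseteq> S" "B \<subseteq> S"
  shows "symd (f ` A) (f ` B) = f ` symd A B"
proof -
  have "f ` (A - B) = f ` A - f ` B" "f ` (B - A) = f ` B - f ` A"
    using assms by (meson Diff_subset inj_on_image_set_diff order_trans)+
  then show ?thesis by (simp add: symd_def image_Un)
qed

definition rot :: "nat \<Rightarrow> int \<Rightarrow> nat \<Rightarrow> nat" where
  "rot N l i = nat ((int i + l) mod int N)"

lemma shift_rot: "shift N Y l = rot N l ` Y"
  by (simp add: shift_def rot_def)

lemma rot_less: "N > 0 \<Longrightarrow> rot N l i < N"
  by (simp add: rot_def nat_less_iff)

lemma int_rot: "N > 0 \<Longrightarrow> int (rot N l i) = (int i + l) mod int N"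
  by (simp add: rot_def)

lemma rot_rot: "N > 0 \<Longrightarrow> rot N b (rot N a i) = rot N (a + b) i"
  by (simp add: rot_def mod_simps algebra_simps)

lemma rot_cong: "a mod int N = b mod int N \<Longrightarrow> rot N a i = rot N b i"
  unfolding rot_def by (metis mod_add_right_eq)

lemma rot_0: "i < N \<Longrightarrow> rot N 0 i = i"
  by (simp add: rot_def)

lemma rot_inverse: "i < N \<Longrightarrow> rot N (- l) (rot N l i) = i" "i < N \<Longrightarrow> rot N l (rot N (- l) i) = i"
  by (simp_all add: rot_rot rot_0)

lemma rot_inj: "inj_on (rot N l) {0..<N}"
  by (rule inj_on_inverseI[of _ "rot N (- l)"]) (simp add: rot_inverse)

lemma rot_Suc: "N > 0 \<Longrightarrow> rot N l (Suc j mod N) = Suc (rot N l j) mod N"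
proof -
  assume N: "N > 0"
  have "int (rot N l (Suc j mod N)) = int (Suc (rot N l j) mod N)"
    using N by (simp add: int_rot zmod_int mod_simps algebra_simps)
  then show ?thesis by linarith
qed

lemma shift_shift: "N > 0 \<Longrightarrow> shift N (shift N Y a) b = shift N Y (a + b)"
  by (simp add: shift_rot image_image rot_rot)

lemma shift_0: "Y \<subseteq> {0..<N} \<Longrightarrow> shift N Y 0 = Y"
  unfolding shift_rot by (force simp: rot_0 image_iff subset_iff)

lemma shift_cong: "a mod int N = b mod int N \<Longrightarrow> shift N Y a = shift N Y b"
  unfolding shift_rot using rot_cong[of a N b] by auto

lemma shift_subset: "N > 0 \<Longrightarrow> shift N Y l \<subseteq> {0..<N}"
  by (auto simp: shift_rot rot_less)

lemma card_shift: "Y \<subseteq> {0..<N} \<Longrightarrow> card (shift N Y l) = card Y"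
  unfolding shift_rot by (meson card_image inj_on_subset rot_inj)

lemma rot_mem_shift: "Y \<subseteq> {0..<N} \<Longrightarrow> i < N \<Longrightarrow> rot N l i \<in> shift N Y l \<longleftrightarrow> i \<in> Y"
  unfolding shift_rot by (rule inj_on_image_mem_iff[OF rot_inj]) auto

lemma shift_symd: "A \<subseteq> {0..<N} \<Longrightarrow> B \<subseteq> {0..<N} \<Longrightarrow>
    shift N (symd A B) l = symd (shift N A l) (shift N B l)"
  by (simp add: shift_rot symd_image[OF rot_inj])

lemma bond_subset: "j < N \<Longrightarrow> bond N j \<subseteq> {0..<N}"
  by (auto simp: bond_def)

lemma symd_subset: "A \<subseteq> S \<Longrightarrow> B \<subseteq> S \<Longrightarrow> symd A B \<subseteq> S"
  by (auto simp: symd_def)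

lemma shift_bond: "N > 0 \<Longrightarrow> shift N (bond N j) l = bond N (rot N l j)"
  by (simp add: shift_rot bond_def rot_Suc)

lemma bdry_less: "j \<in> bdry N Y \<Longrightarrow> j < N"
  by (simp add: bdry_def)

lemma finite_bdry [simp]: "finite (bdry N Y)"
  by (simp add: bdry_def)

lemma rot_bdry_iff:
  assumes "Y \<subseteq> {0..<N}" "j < N"
  shows "rot N l j \<in> bdry N (shift N Y l) \<longleftrightarrow> j \<in> bdry N Y"
proof -
  have "N > 0" using assms by simp
  then show ?thesis
    using assms rot_mem_shift[OF assms(1), of j l] rot_mem_shift[OF assms(1), of "Suc j mod N" l]
    by (simp add: bdry_def rot_Suc rot_less)
qed

lemma bdry_shift:
  assumes "Y \<subseteq> {0..<N}"
  shows "bdry N (shift N Y l) = rot N l ` bdry N Y"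
proof (intro set_eqI iffI)
  fix j assume j: "j \<in> bdry N (shift N Y l)"
  then have "j < N" by (rule bdry_less)
  then have "N > 0" by simp
  define i where "i = rot N (- l) j"
  have "j = rot N l i" "i < N"
    using \<open>j < N\<close> by (simp_all add: i_def rot_inverse rot_less)
  then show "j \<in> rot N l ` bdry N Y" using j rot_bdry_iff[OF assms] by auto
next
  fix j assume "j \<in> rot N l ` bdry N Y"
  then show "j \<in> bdry N (shift N Y l)" using rot_bdry_iff[OF assms] bdry_less by auto
qed

lemma card_bdry_shift:
  assumes "Y \<subseteq> {0..<N}"
  shows "card (bdry N (shift N Y l)) = card (bdry N Y)"
proof -
  have "bdry N Y \<subseteq> {0..<N}" by (auto simp: bdry_def)
  then show ?thesis
    unfolding bdry_shift[OF assms] by (meson card_image inj_on_subset rot_inj)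
qed

text \<open>Translations carry bonds to bonds, so hopping commutes with them. This is what allows
  the local equation to be averaged over translates with plane wave factors.\<close>

lemma sum_bdry_shift:
  assumes "Y \<subseteq> {0..<N}"
  shows "(\<Sum>j\<in>bdry N (shift N Y l). g (symd (shift N Y l) (bond N j)))
       = (\<Sum>j\<in>bdry N Y. g (shift N (symd Y (bond N j)) l))"
proof -
  have inj: "inj_on (rot N l) (bdry N Y)"
    by (rule inj_on_subset[OF rot_inj]) (auto simp: bdry_def)
  show ?thesis
    unfolding bdry_shift[OF assms] sum.reindex[OF inj] o_def
  proof (rule sum.cong[OF refl])
    fix j assume "j \<in> bdry N Y"
    then have "j < N" by (rule bdry_less)
    then show "g (symd (shift N Y l) (bond N (rot N l j))) = g (shift N (symd Y (bond N j)) l)"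
      using assms by (simp add: shift_symd bond_subset shift_bond)
  qed
qed

section \<open>Configurations with m down spins and hops between them\<close>

definition Conf :: "nat \<Rightarrow> nat \<Rightarrow> nat set set" where
  "Conf N m = {Y. Y \<subseteq> {0..<N} \<and> card Y = m}"

lemma ConfD: "Y \<in> Conf N m \<Longrightarrow> Y \<subseteq> {0..<N}" "Y \<in> Conf N m \<Longrightarrow> card Y = m"
  by (auto simp: Conf_def)

lemma finite_Conf [simp]: "finite (Conf N m)"
  by (rule finite_subset[of _ "Pow {0..<N}"]) (auto simp: Conf_def)

lemma symd_bond_in:
  assumes "N > 1" "j \<in> bdry N Y"
  shows "j \<in> bdry N (symd Y (bond N j))"
  using assms by (auto simp: bdry_def bond_def symd_iff)

lemma mod_Suc_neq: "N > 1 \<Longrightarrow> j < N \<Longrightarrow> Suc j mod N \<noteq> j"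
  by (cases "Suc j = N") auto

lemma card_symd_bond:
  assumes "N > 1" "j \<in> bdry N Y" "finite Y"
  shows "card (symd Y (bond N j)) = card Y"
proof -
  let ?i = "Suc j mod N"
  have ne: "?i \<noteq> j" using assms by (simp add: mod_Suc_neq bdry_def)
  show ?thesis
  proof (cases "j \<in> Y")
    case True
    then have "?i \<notin> Y" using assms(2) by (simp add: bdry_def)
    then have "symd Y (bond N j) = insert ?i (Y - {j})"
      using True ne by (auto simp: symd_def bond_def)
    then show ?thesis using card_Suc_Diff1[OF \<open>finite Y\<close> True] \<open>?i \<notin> Y\<close> \<open>finite Y\<close>
      by simp
  next
    case False
    then have "?i \<in> Y" using assms(2) by (simp add: bdry_def)
    then have "symd Y (bond N j) = insert j (Y - {?i})"
      using False ne by (auto simp: symd_def bond_def)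
    then show ?thesis using card_Suc_Diff1[OF \<open>finite Y\<close> \<open>?i \<in> Y\<close>] False \<open>finite Y\<close>
      by simp
  qed
qed

lemma Conf_symd_bond:
  assumes "N > 1" "Y \<in> Conf N m" "j \<in> bdry N Y"
  shows "symd Y (bond N j) \<in> Conf N m"
proof -
  have "finite Y" using ConfD(1)[OF assms(2)] finite_subset by blast
  then show ?thesis
    using assms card_symd_bond[OF assms(1,3)] bdry_less[OF assms(3)]
    by (simp add: Conf_def symd_subset bond_subset)
qed

lemma Conf_shift: "N > 0 \<Longrightarrow> Y \<in> Conf N m \<Longrightarrow> shift N Y l \<in> Conf N m"
  by (simp add: Conf_def shift_subset card_shift)

text \<open>A hop across a fixed bond \<open>j\<close> is an involution, so the pairs
  \<open>(Y, j)\<close> can be reindexed by their images. This is the symmetry of the hopping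
  matrix; it is used to move a hop from a function onto its weight.\<close>

lemma sum_swap_bond:
  fixes F :: "nat set \<Rightarrow> nat set \<Rightarrow> real"
  assumes "N > 1"
  shows "(\<Sum>Y\<in>Conf N m. \<Sum>j\<in>bdry N Y. F Y (symd Y (bond N j)))
       = (\<Sum>Y\<in>Conf N m. \<Sum>j\<in>bdry N Y. F (symd Y (bond N j)) Y)"
proof -
  let ?f = "\<lambda>(Y, j). (symd Y (bond N j), j)"
  have "(\<Sum>(Y,j)\<in>Sigma (Conf N m) (bdry N). F Y (symd Y (bond N j)))
      = (\<Sum>(Y,j)\<in>Sigma (Conf N m) (bdry N). F (symd Y (bond N j)) Y)"
    by (rule sum.reindex_bij_witness[of _ ?f ?f])
      (auto simp: symd_bond_in[OF assms] Conf_symd_bond[OF assms])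
  then show ?thesis by (simp add: sum.Sigma)
qed

section \<open>Hop distance from the droplet M\<close>

definition stp :: "nat \<Rightarrow> nat set \<Rightarrow> nat set \<Rightarrow> bool" where
  "stp N A B \<longleftrightarrow> (\<exists>j\<in>bdry N A. B = symd A (bond N j))"

definition dst :: "nat \<Rightarrow> nat \<Rightarrow> nat set \<Rightarrow> nat" where
  "dst N m Y = (LEAST n. (stp N ^^ n) (Mset m) Y)"

lemma reach_iff: "reach N m n X \<longleftrightarrow> (stp N ^^ n) (Mset m) (symd X (Mset m))"
proof
  show "reach N m n X \<Longrightarrow> (stp N ^^ n) (Mset m) (symd X (Mset m))"
  proof (induction rule: reach.induct)
    case reach0
    then show ?case by simp
  next
    case (reachS n X j)
    have "stp N (symd X (Mset m)) (symd (symd X (bond N j)) (Mset m))"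
      unfolding stp_def using reachS symd_right_commute by blast
    then show ?case using reachS.IH by (auto intro: relcomppI)
  qed
next
  have "(stp N ^^ n) (Mset m) Y \<Longrightarrow> reach N m n (symd Y (Mset m))" for Y
  proof (induction n arbitrary: Y)
    case 0
    then show ?case by (auto intro: reach0)
  next
    case (Suc n)
    then obtain Z where Z: "(stp N ^^ n) (Mset m) Z" "stp N Z Y" by auto
    then obtain j where j: "j \<in> bdry N Z" "Y = symd Z (bond N j)" by (auto simp: stp_def)
    have "reach N m n (symd Z (Mset m))" using Suc.IH Z by blast
    from reachS[OF this, of j] j show ?case
      by (simp add: symd_right_commute)
  qed
  from this[of "symd X (Mset m)"]
  show "(stp N ^^ n) (Mset m) (symd X (Mset m)) \<Longrightarrow> reach N m n X" by simp
qed

lemma wX_eq: "wX N m X = dst N m (symd X (Mset m))"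
  by (simp add: wX_def dst_def reach_iff)

lemma stp_sym: "N > 1 \<Longrightarrow> stp N A B \<Longrightarrow> stp N B A"
  unfolding stp_def using symd_bond_in symd_cancel by metis

lemma stp_shift:
  assumes "A \<subseteq> {0..<N}" "stp N A B"
  shows "stp N (shift N A l) (shift N B l)"
proof -
  obtain j where j: "j \<in> bdry N A" "B = symd A (bond N j)" using assms by (auto simp: stp_def)
  then have "j < N" "rot N l j \<in> bdry N (shift N A l)"
    using assms(1) bdry_less rot_bdry_iff by blast+
  moreover have "shift N B l = symd (shift N A l) (bond N (rot N l j))"
    using j \<open>j < N\<close> assms(1) by (simp add: shift_symd bond_subset shift_bond)
  ultimately show ?thesis unfolding stp_def by blast
qed

lemma stp_subset: "A \<subseteq> {0..<N} \<Longrightarrow> stp N A B \<Longrightarrow> B \<subseteq> {0..<N}"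
  unfolding stp_def by (elim bexE) (simp add: symd_subset bond_subset bdry_less)

lemma relpowp_stp_subset: "(stp N ^^ n) A B \<Longrightarrow> A \<subseteq> {0..<N} \<Longrightarrow> B \<subseteq> {0..<N}"
proof (induction n arbitrary: B)
  case (Suc n)
  then obtain Z where Z: "(stp N ^^ n) A Z" "stp N Z B" by auto
  show ?case by (rule stp_subset[OF Suc.IH[OF Z(1) Suc.prems(2)] Z(2)])
qed simp

lemma relpowp_stp_shift:
  "(stp N ^^ n) A B \<Longrightarrow> A \<subseteq> {0..<N} \<Longrightarrow> (stp N ^^ n) (shift N A l) (shift N B l)"
proof (induction n arbitrary: B)
  case (Suc n)
  then obtain Z where Z: "(stp N ^^ n) A Z" "stp N Z B" by auto
  then have "stp N (shift N Z l) (shift N B l)"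
    by (intro stp_shift[OF relpowp_stp_subset[OF Z(1) Suc.prems(2)]] Z(2))
  then show ?case using Suc.IH[OF Z(1) Suc.prems(2)] by auto
qed simp

lemma relpowp_stp_sym: "N > 1 \<Longrightarrow> (stp N ^^ n) A B \<Longrightarrow> (stp N ^^ n) B A"
proof (induction n arbitrary: B)
  case (Suc n)
  then obtain Z where Z: "(stp N ^^ n) A Z" "stp N Z B" by auto
  then have "stp N B Z" "(stp N ^^ n) Z A" using Suc.IH[OF Suc.prems(1) Z(1)] stp_sym[OF Suc.prems(1) Z(2)] by simp_all
  then show ?case by (metis relpowp_Suc_I2)
qed simp

lemma relpowp_trans: "(R ^^ a) x y \<Longrightarrow> (R ^^ b) y z \<Longrightarrow> (R ^^ (a + b)) x z" for R :: "'a \<Rightarrow> 'a \<Rightarrow> bool"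
  by (auto simp: relpowp_add)

section \<open>Geometry of the droplet and its translates\<close>

locale chain =
  fixes N m :: nat
  assumes m_pos: "0 < m" and m_less: "m < N"
begin

abbreviation "M \<equiv> Mset m"

lemma N1: "N > 1" and N0: "N > 0"
  using m_pos m_less by auto

lemma M_subset: "M \<subseteq> {0..<N}"
  using m_less by (auto simp: Mset_def)

lemma M_Conf: "M \<in> Conf N m"
  using M_subset by (simp add: Conf_def Mset_def)

lemma shift_M_Conf: "shift N M l \<in> Conf N m"
  by (simp add: Conf_shift M_Conf N0)

lemma bdry_M: "bdry N M = {m - 1, N - 1}"
proof -
  have "j \<in> bdry N M \<longleftrightarrow> j = m - 1 \<or> j = N - 1" for j
    using m_pos m_less by (cases "Suc j = N"; cases "Suc j < N") (auto simp: bdry_def Mset_def)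
  then show ?thesis by auto
qed

lemma card_bdry_M: "card (bdry N M) = 2"
  unfolding bdry_M using m_pos m_less by (auto simp: card_insert_if)

lemma card_bdry_shift_M: "card (bdry N (shift N M l)) = 2"
  by (simp add: card_bdry_shift M_subset card_bdry_M)

lemma shift_M_1: "shift N M 1 = {1..m}"
proof -
  have "rot N 1 i = Suc i" if "i < m" for i
    using that m_less by (simp add: rot_def nat_add_distrib)
  then have "shift N M 1 = Suc ` {0..<m}" by (simp add: shift_rot Mset_def)
  then show ?thesis by (simp add: image_Suc_atLeastLessThan atLeastLessThanSuc_atLeastAtMost)
qed

text \<open>A proper interval on the ring has one left and one right edge, and a rotation fixing the
  interval permutes the two. If the left edge bond \<open>N - 1\<close> went to the right edge bond
  \<open>m - 1\<close>, site 0 would go to \<open>m\<close>, outside the interval; so the left edge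
  is fixed, hence site 0, and the rotation is trivial.\<close>

lemma shift_M_inj:
  assumes "shift N M a = shift N M b"
  shows "a mod int N = b mod int N"
proof -
  have eq: "shift N M (a - b) = M"
    using arg_cong[OF assms, of "\<lambda>Y. shift N Y (- b)"] by (simp add: shift_shift N0 shift_0 M_subset)
  have "rot N (a - b) 0 \<in> M" using eq m_pos by (auto simp: shift_rot Mset_def)
  then have lt: "rot N (a - b) 0 < m" by (simp add: Mset_def)
  have "bdry N M = rot N (a - b) ` bdry N M"
    using bdry_shift[OF M_subset, of "a - b"] eq by simp
  moreover have "m - 1 \<noteq> N - 1" using m_pos m_less by simp
  ultimately have "rot N (a - b) (N - 1) \<in> {m - 1, N - 1}"
    by (auto simp: bdry_M)
  moreover have "rot N (a - b) (N - 1) = m - 1 \<Longrightarrow> False"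
  proof -
    assume "rot N (a - b) (N - 1) = m - 1"
    moreover have "Suc (N - 1) mod N = 0" using N0 by simp
    ultimately have "rot N (a - b) 0 = m"
      using rot_Suc[OF N0, of "a - b" "N - 1"] m_pos m_less by simp
    then show False using lt by simp
  qed
  ultimately have "rot N (a - b) (N - 1) = N - 1" by auto
  then have "rot N (a - b) 0 = 0"
    using rot_Suc[OF N0, of "a - b" "N - 1"] N0 by simp
  then have "(a - b) mod int N = 0"
    using int_rot[OF N0, of "a - b" 0] by simp
  then show ?thesis by (simp add: mod_eq_dvd_iff mod_0_imp_dvd)
qed

lemma shift_M_inj_on: "inj_on (\<lambda>n. shift N M (int n)) {1..N}" "inj_on (\<lambda>n. shift N M (- int n)) {1..N}"
proof -
  have *: "a = b" if "a \<in> {1..N}" "b \<in> {1..N}" "int a mod int N = int b mod int N" for a b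
  proof -
    have "int (a mod N) = int (b mod N)" using that by (simp add: zmod_int)
    then have "a mod N = b mod N" by linarith
    then show ?thesis using that by (cases "a = N"; cases "b = N") auto
  qed
  show "inj_on (\<lambda>n. shift N M (int n)) {1..N}"
    by (rule inj_onI) (use * shift_M_inj in blast)
  show "inj_on (\<lambda>n. shift N M (- int n)) {1..N}"
  proof (rule inj_onI)
    fix a b assume ab: "a \<in> {1..N}" "b \<in> {1..N}" "shift N M (- int a) = shift N M (- int b)"
    then have "(- int a) mod int N = (- int b) mod int N" using shift_M_inj by blast
    then have "int a mod int N = int b mod int N"
      by (metis add.inverse_inverse mod_minus_cong)
    then show "a = b" using * ab by blast
  qed
qed

lemma shift_M_eq_M: "n \<in> {1..<N} \<Longrightarrow> shift N M (int n) \<noteq> M"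
proof
  assume n: "n \<in> {1..<N}" and "shift N M (int n) = M"
  then have "shift N M (int n) = shift N M 0" by (simp add: shift_0 M_subset)
  then have "int n mod int N = 0" using shift_M_inj by fastforce
  then show False using n by (simp)
qed

lemma shift_reduce: "\<exists>n\<in>{1..N}. shift N Y l = shift N Y (int n)"
proof -
  define r where "r = nat (l mod int N)"
  have r: "int r = l mod int N" using N0 by (simp add: r_def)
  have "r < N" using N0 by (simp add: r_def nat_less_iff)
  show ?thesis
  proof (cases "r = 0")
    case True
    then have "shift N Y l = shift N Y (int N)" using r by (intro shift_cong) simp
    then show ?thesis using N0 by force
  next
    case False
    have "shift N Y l = shift N Y (int r)" using r by (intro shift_cong) simp
    then show ?thesis using False \<open>r < N\<close> by force
  qed
qed

text \<open>Rotate a site of \<open>Y\<close> with empty left neighbour to 0. The bond left of 0 and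
  the bond at the end of the initial run are boundary bonds; a down spin beyond the first gap would
  create a third. So there is a single run, and its length is forced by the cardinality.\<close>

lemma few_bdry_imp_shift:
  assumes Y: "Y \<in> Conf N m" and le: "card (bdry N Y) \<le> 2"
  shows "\<exists>l. Y = shift N M l"
proof -
  have Ys: "Y \<subseteq> {0..<N}" and c: "card Y = m" using Y by (auto simp: Conf_def)
  have finY: "finite Y" using Ys finite_subset by blast
  have "\<exists>a<N. a \<in> Y \<and> (\<exists>b<N. Suc b mod N = a \<and> b \<notin> Y)"
  proof (rule ccontr)
    assume H: "\<not> ?thesis"
    \<comment> \<open>Without such a site, absence from \<open>Y\<close> propagates to the right
      around the whole ring and empties \<open>Y\<close>.\<close>
    have st: "Suc b mod N \<notin> Y" if "b < N" "b \<notin> Y" for b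
      using H that mod_less_divisor[OF N0, of "Suc b"] by blast
    have "Y \<noteq> {0..<N}" using c m_less by auto
    then have "\<not> {0..<N} \<subseteq> Y" using Ys by blast
    then obtain b where b: "b < N" "b \<notin> Y" by (auto simp: subset_iff)
    have "(b + i) mod N \<notin> Y" for i
    proof (induction i)
      case 0 then show ?case using b by simp
    next
      case (Suc i)
      from st[OF _ Suc] N0 show ?case by (simp add: mod_Suc_eq)
    qed
    moreover have "\<exists>i. y = (b + i) mod N" if "y < N" for y
      by (rule exI[of _ "N - b + y"]) (use that b in auto)
    ultimately have "Y = {}" using Ys by fastforce
    then show False using c m_pos by simp
  qed
  then obtain a b where ab: "a \<in> Y" "a < N" "b < N" "Suc b mod N = a" "b \<notin> Y" by blast
  define Z where "Z = shift N Y (- int a)"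
  have Zs: "Z \<subseteq> {0..<N}" by (simp add: Z_def shift_subset N0)
  have Zc: "card (bdry N Z) \<le> 2" "card Z = m" using le c
    by (simp_all add: Z_def card_bdry_shift Ys card_shift)
  have ra: "rot N (- int a) a = 0" by (simp add: rot_def)
  have "rot N (- int a) b = N - 1"
  proof -
    have "Suc (rot N (- int a) b) mod N = 0" using rot_Suc[OF N0, of "- int a" b] ab ra by simp
    then show ?thesis using rot_less[OF N0, of "- int a" b]
      by (metis Suc_lessI diff_Suc_1 mod_less nat.distinct(1))
  qed
  then have Z0: "0 \<in> Z" "N - 1 \<notin> Z"
    using rot_mem_shift[OF Ys ab(2), of "- int a"] rot_mem_shift[OF Ys ab(3), of "- int a"] ab ra
    by (auto simp: Z_def)
  define r where "r = (LEAST i. i \<notin> Z)"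
  have rZ: "r \<notin> Z" unfolding r_def using Z0(2) by (rule LeastI)
  have lt: "i \<in> Z" if "i < r" for i using that not_less_Least r_def by blast
  have r0: "r > 0" using rZ Z0 by (cases r) auto
  have rN: "r \<le> N - 1" unfolding r_def using Z0(2) by (rule Least_le)
  have in1: "N - 1 \<in> bdry N Z" using Z0 N0 by (simp add: bdry_def)
  have in2: "r - 1 \<in> bdry N Z" using lt[of "r - 1"] rZ r0 rN by (simp add: bdry_def)
  have out: "i \<notin> Z" if "r \<le> i" "i < N" for i
    using that
  proof (induction i rule: dec_induct)
    case base then show ?case using rZ by simp
  next
    case (step i)
    show ?case
    proof
      assume "Suc i \<in> Z"
      then have "i \<in> bdry N Z" using step by (simp add: bdry_def)
      then have sub: "{N - 1, r - 1, i} \<subseteq> bdry N Z" using in1 in2 by simp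
      have "N - 1 \<noteq> r - 1" "N - 1 \<noteq> i" "r - 1 \<noteq> i" using step r0 rN by linarith+
      then have "card {N - 1, r - 1, i} = 3" by simp
      then show False using card_mono[OF finite_bdry sub] Zc by simp
    qed
  qed
  have "Z = {0..<r}" using lt out Zs by (auto simp: not_less[symmetric]) (meson atLeastLessThan_iff not_le subset_iff)
  then have "Z = M" using Zc by (simp add: Mset_def)
  then have "Y = shift N M (int a)" unfolding Z_def
    by (metis Ys Z_def add.left_inverse shift_0 shift_shift N0)
  then show ?thesis by blast
qed

text \<open>Each boundary bond has exactly one end in \<open>Y\<close>: either its own index is a
  site of \<open>Y\<close>, or the next site is. The bound does not grow with \<open>N\<close>,
  which makes the later maximum argument uniform.\<close>

lemma card_bdry_le: 
  assumes "Y \<in> Conf N m" shows "card (bdry N Y) \<le> 2 * m"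
proof -
  have f: "finite Y" using assms finite_subset by (fastforce simp: Conf_def)
  have "bdry N Y \<subseteq> Y \<union> rot N (-1) ` Y"
  proof
    fix j assume j: "j \<in> bdry N Y"
    show "j \<in> Y \<union> rot N (-1) ` Y"
    proof (cases "j \<in> Y")
      case False
      then have s: "Suc j mod N \<in> Y" and jN: "j < N" using j by (auto simp: bdry_def)
      have "rot N 1 j = Suc j mod N"
        using rot_Suc[OF N0, of 0 j] N0 jN by (simp add: rot_def nat_add_distrib nat_mod_distrib)
      then have "rot N (-1) (Suc j mod N) = j" using rot_inverse(1)[OF jN, of 1] by simp
      then show ?thesis using s by force
    qed simp
  qed
  then have "card (bdry N Y) \<le> card (Y \<union> rot N (-1) ` Y)" using f by (intro card_mono) auto
  also have "\<dots> \<le> card Y + card (rot N (-1) ` Y)" by (rule card_Un_le)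
  also have "\<dots> \<le> 2 * m" using card_image_le[OF f, of "rot N (-1)"] assms by (simp add: Conf_def)
  finally show ?thesis .
qed

text \<open>The empty site just right of the interval is moved through it from right to left; after
  \<open>i\<close> hops it sits at \<open>m - i\<close>, and after \<open>m\<close> hops the
  interval has advanced by one.\<close>

lemma reach_shift_M_1: "(stp N ^^ m) M (shift N M 1)"
proof -
  have "(stp N ^^ i) M ({0..m} - {m - i})" if "i \<le> m" for i
    using that
  proof (induction i)
    case 0
    have "M = {0..m} - {m}" by (auto simp: Mset_def)
    then show ?case by simp
  next
    case (Suc i)
    let ?A = "{0..m} - {m - i}" and ?B = "{0..m} - {m - Suc i}" and ?j = "m - Suc i"
    have Sj: "Suc ?j mod N = m - i" using Suc.prems m_less by (simp add: Suc_diff_Suc)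
    have "?j \<in> bdry N ?A" using Sj Suc.prems m_less by (auto simp: bdry_def)
    moreover have "?B = symd ?A (bond N ?j)"
      using Suc.prems unfolding bond_def Sj by (auto simp: symd_def)
    ultimately have "stp N ?A ?B" unfolding stp_def by blast
    then show ?case using Suc by auto
  qed
  from this[of m] have "(stp N ^^ m) M ({0..m} - {0})" by simp
  moreover have "{0..m} - {0} = shift N M 1" by (auto simp: shift_M_1)
  ultimately show ?thesis by simp
qed

lemma reach_shift_M: "\<exists>n. (stp N ^^ n) M (shift N M (int l))"
proof (induction l)
  case 0
  show ?case by (rule exI[of _ 0]) (simp add: shift_0 M_subset)
next
  case (Suc l)
  then obtain n where "(stp N ^^ n) M (shift N M (int l))" by blast
  from relpowp_stp_shift[OF this M_subset, of 1]
  have "(stp N ^^ n) (shift N M 1) (shift N M (int (Suc l)))"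
    by (simp add: shift_shift N0 add.commute)
  then show ?case using relpowp_trans[OF reach_shift_M_1] by blast
qed

lemma dst_M: "dst N m M = 0"
  unfolding dst_def by (rule Least_eq_0) simp

lemma dst_le: "(stp N ^^ n) M Y \<Longrightarrow> dst N m Y \<le> n"
  unfolding dst_def by (rule Least_le)

lemma dst_path: "(stp N ^^ n) M Y \<Longrightarrow> (stp N ^^ dst N m Y) M Y"
  unfolding dst_def by (rule LeastI)

text \<open>Configurations that cannot be reached from \<open>M\<close> all share the junk value
  \<open>LEAST n. False\<close>, so the distance inequalities below need no connectedness.\<close>

lemma dst_unreachable: "\<nexists>n. (stp N ^^ n) M Y \<Longrightarrow> dst N m Y = (LEAST n. False)"
  unfolding dst_def by simp

lemma dst_stp:
  assumes "stp N Y Z" shows "dst N m Z \<le> Suc (dst N m Y)"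
proof (cases "\<exists>n. (stp N ^^ n) M Y")
  case True
  then have "(stp N ^^ dst N m Y) M Y" using dst_path by blast
  then have "(stp N ^^ Suc (dst N m Y)) M Z" using assms by auto
  then show ?thesis by (rule dst_le)
next
  case False
  have "\<nexists>n. (stp N ^^ n) M Z"
    using False stp_sym[OF N1 assms] by (metis relpowp_Suc_I)
  then show ?thesis using False by (simp add: dst_unreachable)
qed

text \<open>Translate a path from \<open>M\<close> to \<open>M + l\<close> by \<open>- l\<close>,
  then reverse it.\<close>

lemma path_shift_neg: "(stp N ^^ n) M (shift N M l) \<Longrightarrow> (stp N ^^ n) M (shift N M (- l))"
  using relpowp_stp_sym[OF N1 relpowp_stp_shift[OF _ M_subset, of n "shift N M l" "- l"]]
  by (simp add: shift_shift N0 shift_0 M_subset)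

lemma dst_shift_neg: "dst N m (shift N M (- l)) = dst N m (shift N M l)"
proof -
  have "(stp N ^^ n) M (shift N M (- l)) \<longleftrightarrow> (stp N ^^ n) M (shift N M l)" for n
    using path_shift_neg[of n l] path_shift_neg[of n "- l"] by auto
  then show ?thesis by (simp add: dst_def)
qed

text \<open>Go from \<open>M\<close> to \<open>M - s\<close>, which costs as much as going to
  \<open>M + s\<close>, and continue along a path from \<open>M\<close> to \<open>Y + s\<close>
  translated by \<open>- s\<close>; it ends at \<open>Y\<close>.\<close>

lemma dst_shift:
  assumes Y: "Y \<in> Conf N m"
  shows "dst N m Y \<le> dst N m (shift N M (int s)) + dst N m (shift N Y (int s))"
proof -
  let ?Z = "shift N Y (int s)" and ?a = "dst N m (shift N M (int s))"
  have a: "(stp N ^^ ?a) M (shift N M (int s))" using reach_shift_M dst_path by blast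
  then have a': "(stp N ^^ ?a) M (shift N M (- int s))" by (rule path_shift_neg)
  have Yb: "shift N ?Z (- int s) = Y" using Y by (simp add: shift_shift N0 shift_0 ConfD)
  have to: "(stp N ^^ (?a + n)) M Y" if "(stp N ^^ n) M ?Z" for n
    using relpowp_trans[OF a' ] relpowp_stp_shift[OF that M_subset, of "- int s"] by (simp add: Yb)
  have fro: "(stp N ^^ (?a + n)) M ?Z" if "(stp N ^^ n) M Y" for n
    using relpowp_trans[OF a] relpowp_stp_shift[OF that M_subset, of "int s"] by simp
  show ?thesis
  proof (cases "\<exists>n. (stp N ^^ n) M ?Z")
    case True
    then show ?thesis using dst_path to dst_le by blast
  next
    case False
    then have "\<nexists>n. (stp N ^^ n) M Y" using fro by blast
    then show ?thesis using False by (simp add: dst_unreachable)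
  qed
qed

end

section \<open>The weighted norm\<close>

definition Lap :: "nat \<Rightarrow> (nat set \<Rightarrow> real) \<Rightarrow> nat set \<Rightarrow> real" where
  "Lap N g Y = (\<Sum>j\<in>bdry N Y. g (symd Y (bond N j)))"

definition Conv :: "nat \<Rightarrow> (nat \<Rightarrow> real) \<Rightarrow> (nat set \<Rightarrow> real) \<Rightarrow> nat set \<Rightarrow> real" where
  "Conv N E g Y = (\<Sum>s=1..N. E s * g (shift N Y (int s)))"

definition Conf2 :: "nat \<Rightarrow> nat \<Rightarrow> nat set set" where
  "Conf2 N m = {Y \<in> Conf N m. 2 < card (bdry N Y)}"

text \<open>The sign of the shift is dictated by \<open>Conv\<close>: for normalised
  \<open>f\<close>, at \<open>M - n\<close> only the term \<open>s = n\<close> of the convolution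
  meets \<open>M\<close>, so the equation at \<open>M - n\<close> determines
  \<open>E n\<close>.\<close>

definition stepE :: "nat \<Rightarrow> nat \<Rightarrow> real \<Rightarrow> (nat set \<Rightarrow> real) \<Rightarrow> nat \<Rightarrow> real" where
  "stepE N m \<epsilon> f n = 2 * \<epsilon> * Lap N f (shift N (Mset m) (- int n))"

text \<open>The normalisation is built into the map, so that every image is normalised and the
  iteration never leaves the affine space of admissible functions.\<close>

definition stepF :: "nat \<Rightarrow> nat \<Rightarrow> real \<Rightarrow> (nat \<Rightarrow> real) \<Rightarrow> (nat set \<Rightarrow> real) \<Rightarrow> nat set \<Rightarrow> real" where
  "stepF N m \<epsilon> E f Y =
    (if Y = Mset m then 1
     else if Y \<in> Conf2 N m then
       - \<epsilon> / (real (card (bdry N Y)) - 2) * Lap N f Y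
       + 1/2 * (1 / (real (card (bdry N Y)) - 2)) * Conv N E f Y
     else 0)"

definition normalised :: "nat \<Rightarrow> nat \<Rightarrow> (nat set \<Rightarrow> real) \<Rightarrow> bool" where
  "normalised N m f \<longleftrightarrow> f (Mset m) = 1 \<and> (\<forall>n\<in>{1..<N}. f (shift N (Mset m) (int n)) = 0)"

text \<open>The fixed point equation in terms of \<open>f Y = e (Y \<Delta> M)\<close>: indexed by configurations,
  the translations and moves act without reference to \<open>M\<close>.\<close>

definition conf_fp :: "nat \<Rightarrow> nat \<Rightarrow> real \<Rightarrow> (nat \<Rightarrow> real) \<Rightarrow> (nat set \<Rightarrow> real) \<Rightarrow> bool" where
  "conf_fp N m \<epsilon> E f \<longleftrightarrow> normalised N m f \<and> (\<forall>n\<in>{1..N}. E n = stepE N m \<epsilon> f n)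
     \<and> (\<forall>Y\<in>Conf2 N m. f Y = stepF N m \<epsilon> E f Y)"

definition wt :: "nat \<Rightarrow> nat \<Rightarrow> real \<Rightarrow> nat set \<Rightarrow> real" where
  "wt N m k Y = inverse (k ^ dst N m Y)"

definition NE :: "nat \<Rightarrow> nat \<Rightarrow> real \<Rightarrow> (nat \<Rightarrow> real) \<Rightarrow> real" where
  "NE N m k E = (\<Sum>n=1..N. \<bar>E n\<bar> * wt N m k (shift N (Mset m) (int n)))"

text \<open>The factor with \<open>- 2\<close> cancels the denominator of \<open>stepF\<close> and
  vanishes on all translates of \<open>M\<close>, where normalised functions are prescribed. The
  leading 2 matches the 2 in \<open>stepE\<close>, so that the hop terms of both components combine
  into one sum.\<close>

definition NF :: "nat \<Rightarrow> nat \<Rightarrow> real \<Rightarrow> (nat set \<Rightarrow> real) \<Rightarrow> real" where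
  "NF N m k g = 2 * (\<Sum>Y\<in>Conf N m. \<bar>g Y\<bar> * (real (card (bdry N Y)) - 2) * wt N m k Y)"

context chain
begin

lemma M_notin_Conf2: "shift N M l \<notin> Conf2 N m" "M \<notin> Conf2 N m"
  using card_bdry_shift_M card_bdry_M by (auto simp: Conf2_def)

text \<open>Two enumerations of the translates are kept because \<open>M + n\<close> labels the
  weights in the norm while \<open>M - n\<close> is where the \<open>E\<close> equation is
  evaluated.\<close>

lemma Conf_eq: "Conf N m = Conf2 N m \<union> (\<lambda>n. shift N M (int n)) ` {1..N}"
  "Conf N m = Conf2 N m \<union> (\<lambda>n. shift N M (- int n)) ` {1..N}"
proof -
  have *: "\<exists>l. Y = shift N M l" if "Y \<in> Conf N m" "Y \<notin> Conf2 N m" for Y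
    using few_bdry_imp_shift that by (auto simp: Conf2_def not_less)
  then have "Y \<in> (\<lambda>n. shift N M (int n)) ` {1..N}" if "Y \<in> Conf N m" "Y \<notin> Conf2 N m" for Y
    using that shift_reduce by (metis image_eqI)
  then show "Conf N m = Conf2 N m \<union> (\<lambda>n. shift N M (int n)) ` {1..N}"
    using shift_M_Conf by (auto simp: Conf2_def)
  have "Y \<in> (\<lambda>n. shift N M (- int n)) ` {1..N}" if Y: "Y \<in> Conf N m" "Y \<notin> Conf2 N m" for Y
  proof -
    obtain l where l: "Y = shift N M l" using *[OF Y] by blast
    obtain n where "n \<in> {1..N}" "shift N M (- l) = shift N M (int n)"
      using shift_reduce by blast
    then have "(- l) mod int N = int n mod int N" by (intro shift_M_inj)
    then have "l mod int N = (- int n) mod int N" by (metis add.inverse_inverse mod_minus_cong)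
    then show ?thesis using l \<open>n \<in> {1..N}\<close> shift_cong by blast
  qed
  then show "Conf N m = Conf2 N m \<union> (\<lambda>n. shift N M (- int n)) ` {1..N}"
    using shift_M_Conf by (auto simp: Conf2_def)
qed

lemma sum_Conf: 
  fixes h :: "nat set \<Rightarrow> real"
  shows "(\<Sum>Y\<in>Conf N m. h Y) = (\<Sum>Y\<in>Conf2 N m. h Y) + (\<Sum>n=1..N. h (shift N M (int n)))"
    "(\<Sum>Y\<in>Conf N m. h Y) = (\<Sum>Y\<in>Conf2 N m. h Y) + (\<Sum>n=1..N. h (shift N M (- int n)))"
proof -
  have fin: "finite (Conf2 N m)" by (simp add: Conf2_def)
  have "(\<Sum>Y\<in>Conf N m. h Y) = (\<Sum>Y\<in>Conf2 N m. h Y) + (\<Sum>Y\<in>(\<lambda>n. shift N M (int n)) ` {1..N}. h Y)"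
    unfolding Conf_eq(1) using fin M_notin_Conf2 by (intro sum.union_disjoint) auto
  then show "(\<Sum>Y\<in>Conf N m. h Y) = (\<Sum>Y\<in>Conf2 N m. h Y) + (\<Sum>n=1..N. h (shift N M (int n)))"
    using sum.reindex[OF shift_M_inj_on(1), of h] by (simp add: o_def)
  have "(\<Sum>Y\<in>Conf N m. h Y) = (\<Sum>Y\<in>Conf2 N m. h Y) + (\<Sum>Y\<in>(\<lambda>n. shift N M (- int n)) ` {1..N}. h Y)"
    unfolding Conf_eq(2) using fin M_notin_Conf2 by (intro sum.union_disjoint) auto
  then show "(\<Sum>Y\<in>Conf N m. h Y) = (\<Sum>Y\<in>Conf2 N m. h Y) + (\<Sum>n=1..N. h (shift N M (- int n)))"
    using sum.reindex[OF shift_M_inj_on(2), of h] by (simp add: o_def)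
qed

lemma finite_Conf2 [simp]: "finite (Conf2 N m)"
  by (simp add: Conf2_def)

lemma shift_M_N: "shift N M (int N) = M"
  using shift_cong[of "int N" N 0 M] by (simp add: shift_0 M_subset)

lemma Conf2_shift: "Y \<in> Conf2 N m \<Longrightarrow> shift N Y l \<in> Conf2 N m"
  using card_bdry_shift[of Y N l] ConfD(1)[of Y N m] by (auto simp: Conf2_def Conf_shift N0)

lemma sum_Conf2_shift:
  fixes h :: "nat set \<Rightarrow> real"
  shows "(\<Sum>Y\<in>Conf2 N m. h (shift N Y l)) = (\<Sum>Y\<in>Conf2 N m. h Y)"
proof (rule sum.reindex_bij_witness[of _ "\<lambda>Y. shift N Y (- l)" "\<lambda>Y. shift N Y l"])
qed (auto simp: Conf2_shift, auto simp: Conf2_def shift_shift N0 shift_0 ConfD)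

lemma NF_Conf2: "NF N m k g = 2 * (\<Sum>Y\<in>Conf2 N m. \<bar>g Y\<bar> * (real (card (bdry N Y)) - 2) * wt N m k Y)"
  unfolding NF_def sum_Conf(1) by (simp add: card_bdry_shift_M)

text \<open>Under \<open>Y = symd X M\<close> the argument of \<open>e\<close> in the quadratic term
  becomes the translate \<open>Y + s\<close>, seen relative to \<open>M\<close>; the remaining terms
  only change their index.\<close>

lemma is_fp_iff: "is_fp N m \<epsilon> es e \<longleftrightarrow> conf_fp N m \<epsilon> es (\<lambda>Y. e (symd Y M))"
proof -
  let ?f = "\<lambda>Y. e (symd Y M)"
  have 1: "Lap N ?f Y = (\<Sum>j\<in>bdry N Y. e (symd (symd Y M) (bond N j)))" for Y
    by (simp add: Lap_def symd_right_commute)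
  have 2: "(\<forall>X\<in>Xset N m. nX N m X > 2 \<longrightarrow> P X) \<longleftrightarrow> (\<forall>Y\<in>Conf2 N m. P (symd Y M))" for P
  proof
    assume H: "\<forall>X\<in>Xset N m. nX N m X > 2 \<longrightarrow> P X"
    show "\<forall>Y\<in>Conf2 N m. P (symd Y M)"
      using H by (auto simp: Conf2_def Conf_def Xset_def nX_def symd_subset M_subset)
  next
    assume H: "\<forall>Y\<in>Conf2 N m. P (symd Y M)"
    show "\<forall>X\<in>Xset N m. nX N m X > 2 \<longrightarrow> P X"
    proof (intro ballI impI)
      fix X assume "X \<in> Xset N m" "nX N m X > 2"
      then have "symd X M \<in> Conf2 N m"
        by (auto simp: Conf2_def Conf_def Xset_def nX_def symd_subset M_subset)
      then show "P X" using H by fastforce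
    qed
  qed
  have 3: "Conv N es ?f Y = (\<Sum>s=1..N. es s *
      e (symd (symd (shift N (symd Y M) (int s)) (shift N M (int s))) M))" if "Y \<in> Conf2 N m" for Y
    proof -
    have "Y \<subseteq> {0..<N}" using that ConfD by (auto simp: Conf2_def)
    then show ?thesis by (simp add: Conv_def shift_symd M_subset symd_subset)
  qed
  have 4: "stepF N m \<epsilon> es ?f Y = - \<epsilon> / (real (card (bdry N Y)) - 2) * Lap N ?f Y
       + 1/2 * (1 / (real (card (bdry N Y)) - 2)) * Conv N es ?f Y" if "Y \<in> Conf2 N m" for Y
    using that M_notin_Conf2 by (auto simp: stepF_def)
  show ?thesis
    unfolding is_fp_def conf_fp_def normalised_def 2 stepE_def 1
    using 3 4 1 by (simp add: nX_def symd_commute[of M] cong: ball_cong)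
qed

lemma fp_norm_eq:
  "fp_norm N m K \<epsilon> es e = NE N m (K * \<bar>\<epsilon>\<bar>) es + NF N m (K * \<bar>\<epsilon>\<bar>) (\<lambda>Y. e (symd Y M))"
proof -
  have "(\<Sum>X\<in>Xset N m. \<bar>e X\<bar> * (real (nX N m X) - 2) * inverse ((K * \<bar>\<epsilon>\<bar>) ^ wX N m X))
     = (\<Sum>Y\<in>Conf N m. \<bar>e (symd Y M)\<bar> * (real (card (bdry N Y)) - 2) * wt N m (K * \<bar>\<epsilon>\<bar>) Y)"
    by (rule sum.reindex_bij_witness[of _ "\<lambda>Y. symd Y M" "\<lambda>Y. symd Y M"])
      (auto simp: Conf_def Xset_def nX_def wX_eq wt_def symd_subset M_subset)
  then show ?thesis
    unfolding fp_norm_def NE_def NF_def wn_def wX_eq wt_def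
    by (simp add: symd_commute[of M])
qed

end

section \<open>Weighted estimates for hops and convolutions\<close>

locale weighted_chain = chain +
  fixes k :: real
  assumes k_pos: "0 < k" and k_le: "k \<le> 1"
begin

lemma wt_ge1: "wt N m k Y \<ge> 1"
  unfolding wt_def using k_pos k_le by (simp add: one_le_inverse power_le_one)

lemma wt_pos: "wt N m k Y > 0" "wt N m k Y \<ge> 0"
  using wt_ge1[of Y] by linarith+

lemma wt_mono: "dst N m Y \<le> d \<Longrightarrow> wt N m k Y \<le> inverse (k ^ d)"
  unfolding wt_def using k_pos k_le by (intro le_imp_inverse_le) (auto intro: power_decreasing)

lemma wt_M: "wt N m k M = 1"
  by (simp add: wt_def dst_M)

lemma wt_bond:
  assumes "j \<in> bdry N Y"
  shows "wt N m k (symd Y (bond N j)) \<le> inverse k * wt N m k Y"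
proof -
  have "stp N Y (symd Y (bond N j))" using assms by (auto simp: stp_def)
  from wt_mono[OF dst_stp[OF this]] show ?thesis by (simp add: wt_def mult.commute)
qed

lemma wt_shift: "Y \<in> Conf N m \<Longrightarrow>
    wt N m k Y \<le> wt N m k (shift N M (int s)) * wt N m k (shift N Y (int s))"
  using wt_mono[OF dst_shift, of Y s] by (simp add: wt_def power_add)

lemma wt_shift_neg: "wt N m k (shift N M (- l)) = wt N m k (shift N M l)"
  by (simp add: wt_def dst_shift_neg)

lemma NE_nonneg: "NE N m k E \<ge> 0"
  unfolding NE_def by (intro sum_nonneg mult_nonneg_nonneg) (simp_all add: wt_pos)

lemma NF_nonneg: "NF N m k g \<ge> 0"
  unfolding NF_Conf2 by (intro mult_nonneg_nonneg sum_nonneg) (auto simp: wt_pos Conf2_def)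

lemma NE_diff: "NE N m k (\<lambda>n. a n - b n) \<le> NE N m k a + NE N m k b"
  unfolding NE_def sum.distrib[symmetric]
  by (intro sum_mono) (simp add: wt_pos mult_right_mono flip: distrib_right)

lemma NF_diff: "NF N m k (\<lambda>n. a n - b n) \<le> NF N m k a + NF N m k b"
proof -
  have "NF N m k (\<lambda>n. a n - b n) \<le> 2 * (\<Sum>Y\<in>Conf2 N m. \<bar>a Y\<bar> * (real (card (bdry N Y)) - 2) * wt N m k Y
     + \<bar>b Y\<bar> * (real (card (bdry N Y)) - 2) * wt N m k Y)"
    unfolding NF_Conf2
    by (intro mult_left_mono sum_mono)
      (auto simp: wt_pos Conf2_def intro!: mult_right_mono simp flip: distrib_right)
  then show ?thesis by (simp add: NF_Conf2 sum.distrib)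
qed

lemma NE_coord: "n \<in> {1..N} \<Longrightarrow> \<bar>E n\<bar> * wt N m k (shift N M (int n)) \<le> NE N m k E"
  unfolding NE_def by (rule member_le_sum[of n "{1..N}" "\<lambda>n. \<bar>E n\<bar> * wt N m k (shift N M (int n))"])
    (auto simp: wt_pos)

lemma NE_coord1: "n \<in> {1..N} \<Longrightarrow> \<bar>E n\<bar> \<le> NE N m k E"
  using NE_coord[of n E] mult_left_mono[OF wt_ge1, of "\<bar>E n\<bar>" "shift N M (int n)"] by simp

lemma sum_abs_le_NE: "(\<Sum>n=1..N. \<bar>E n\<bar>) \<le> NE N m k E"
  unfolding NE_def
proof (rule sum_mono)
  fix n show "\<bar>E n\<bar> \<le> \<bar>E n\<bar> * wt N m k (shift N M (int n))"
    using mult_left_mono[OF wt_ge1, of "\<bar>E n\<bar>" "shift N M (int n)"] by simp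
qed

lemma sum_wt_le_NF: "(\<Sum>Y\<in>Conf2 N m. \<bar>g Y\<bar> * wt N m k Y) \<le> NF N m k g / 2"
proof -
  have "(\<Sum>Y\<in>Conf2 N m. \<bar>g Y\<bar> * wt N m k Y)
     \<le> (\<Sum>Y\<in>Conf2 N m. \<bar>g Y\<bar> * (real (card (bdry N Y)) - 2) * wt N m k Y)"
  proof (rule sum_mono)
    fix Y assume "Y \<in> Conf2 N m"
    then have "1 \<le> real (card (bdry N Y)) - 2" by (auto simp: Conf2_def)
    from mult_left_mono[OF this, of "\<bar>g Y\<bar> * wt N m k Y"]
    show "\<bar>g Y\<bar> * wt N m k Y \<le> \<bar>g Y\<bar> * (real (card (bdry N Y)) - 2) * wt N m k Y"
      using wt_pos[of Y] by (simp add: mult_ac)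
  qed
  then show ?thesis unfolding NF_Conf2 by simp
qed

lemma sum_abs_le_NF: "(\<Sum>Y\<in>Conf2 N m. \<bar>g Y\<bar>) \<le> NF N m k g / 2"
proof -
  have "(\<Sum>Y\<in>Conf2 N m. \<bar>g Y\<bar>) \<le> (\<Sum>Y\<in>Conf2 N m. \<bar>g Y\<bar> * wt N m k Y)"
  proof (rule sum_mono)
    fix Y show "\<bar>g Y\<bar> \<le> \<bar>g Y\<bar> * wt N m k Y"
      using mult_left_mono[OF wt_ge1, of "\<bar>g Y\<bar>" Y] by simp
  qed
  then show ?thesis using sum_wt_le_NF[of g] by linarith
qed

lemma NF_coord: "Y \<in> Conf2 N m \<Longrightarrow> \<bar>g Y\<bar> \<le> NF N m k g / 2"
  using sum_abs_le_NF[of g] member_le_sum[of Y "Conf2 N m" "\<lambda>Y. \<bar>g Y\<bar>"] by simp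

lemma sum_bdry_weight:
  assumes "\<forall>n\<in>{1..<N}. g (shift N M (int n)) = 0"
  shows "(\<Sum>Y\<in>Conf N m. real (card (bdry N Y)) * (\<bar>g Y\<bar> * wt N m k Y)) \<le> 2 * \<bar>g M\<bar> + 3/2 * NF N m k g"
proof -
  have "(\<Sum>Y\<in>Conf2 N m. real (card (bdry N Y)) * (\<bar>g Y\<bar> * wt N m k Y))
     \<le> 3 * (\<Sum>Y\<in>Conf2 N m. \<bar>g Y\<bar> * (real (card (bdry N Y)) - 2) * wt N m k Y)"
    unfolding sum_distrib_left
  proof (rule sum_mono)
    fix Y assume "Y \<in> Conf2 N m"
    \<comment> \<open>A count \<open>c \<ge> 3\<close> satisfies \<open>c \<le> 3 * (c - 2)\<close>;
      divided by the factor 2 in \<open>NF\<close>, this gives the coefficient 3/2.\<close>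
    then have "real (card (bdry N Y)) \<le> 3 * (real (card (bdry N Y)) - 2)" by (auto simp: Conf2_def)
    from mult_right_mono[OF this, of "\<bar>g Y\<bar> * wt N m k Y"]
    show "real (card (bdry N Y)) * (\<bar>g Y\<bar> * wt N m k Y)
       \<le> 3 * (\<bar>g Y\<bar> * (real (card (bdry N Y)) - 2) * wt N m k Y)"
      using wt_pos[of Y] by (simp add: algebra_simps)
  qed
  moreover have "(\<Sum>n=1..N. 2 * (\<bar>g (shift N M (int n))\<bar> * wt N m k (shift N M (int n)))) = 2 * \<bar>g M\<bar>"
  proof -
    have "{1..N} = insert N {1..<N}" using N0 by auto
    then show ?thesis using assms by (simp add: shift_M_N wt_M)
  qed
  ultimately show ?thesis
    unfolding sum_Conf(1) NF_Conf2 by (simp add: card_bdry_shift_M)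
qed

text \<open>Exchanging the two ends of every hop puts the flipped configuration into the weight
  instead of \<open>g\<close>, and there it costs one factor \<open>inverse k\<close>. What remains
  counts the boundary bonds of \<open>Y\<close>.\<close>

lemma Lap_bound:
  "(\<Sum>Y\<in>Conf N m. \<bar>Lap N g Y\<bar> * wt N m k Y)
     \<le> inverse k * (\<Sum>Y\<in>Conf N m. real (card (bdry N Y)) * (\<bar>g Y\<bar> * wt N m k Y))"
proof -
  have "(\<Sum>Y\<in>Conf N m. \<bar>Lap N g Y\<bar> * wt N m k Y)
      \<le> (\<Sum>Y\<in>Conf N m. \<Sum>j\<in>bdry N Y. \<bar>g (symd Y (bond N j))\<bar> * wt N m k Y)"
    unfolding Lap_def
    by (intro sum_mono) (simp add: sum_abs wt_pos mult_right_mono flip: sum_distrib_right)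
  also have "\<dots> = (\<Sum>Y\<in>Conf N m. \<Sum>j\<in>bdry N Y. \<bar>g Y\<bar> * wt N m k (symd Y (bond N j)))"
    by (rule sum_swap_bond[OF N1])
  also have "\<dots> \<le> (\<Sum>Y\<in>Conf N m. \<Sum>j\<in>bdry N Y. \<bar>g Y\<bar> * (inverse k * wt N m k Y))"
    by (intro sum_mono mult_left_mono wt_bond) auto
  also have "\<dots> = inverse k * (\<Sum>Y\<in>Conf N m. real (card (bdry N Y)) * (\<bar>g Y\<bar> * wt N m k Y))"
    by (simp add: sum_distrib_left mult_ac)
  finally show ?thesis .
qed

text \<open>The weight at \<open>Y\<close> splits into one for the translation and one for
  \<open>Y + s\<close>. Since translations permute \<open>Conf2\<close>, the inner sum no longer
  depends on \<open>s\<close>, and the two norms factor.\<close>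

lemma Conv_bound:
  "(\<Sum>Y\<in>Conf2 N m. \<bar>Conv N E g Y\<bar> * wt N m k Y) \<le> NE N m k E * (NF N m k g / 2)"
proof -
  have "(\<Sum>Y\<in>Conf2 N m. \<bar>Conv N E g Y\<bar> * wt N m k Y)
     \<le> (\<Sum>Y\<in>Conf2 N m. \<Sum>s=1..N. \<bar>E s\<bar> * \<bar>g (shift N Y (int s))\<bar> * wt N m k Y)"
    unfolding Conv_def
    by (intro sum_mono) (simp add: sum_abs wt_pos mult_right_mono flip: sum_distrib_right abs_mult)
  also have "\<dots> \<le> (\<Sum>Y\<in>Conf2 N m. \<Sum>s=1..N. \<bar>E s\<bar> * \<bar>g (shift N Y (int s))\<bar> *
      (wt N m k (shift N M (int s)) * wt N m k (shift N Y (int s))))"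
    by (intro sum_mono mult_left_mono wt_shift) (auto simp: Conf2_def)
  also have "\<dots> = (\<Sum>s=1..N. \<bar>E s\<bar> * wt N m k (shift N M (int s)) *
      (\<Sum>Y\<in>Conf2 N m. \<bar>g (shift N Y (int s))\<bar> * wt N m k (shift N Y (int s))))"
    by (subst sum.swap) (simp add: sum_distrib_left mult_ac)
  also have "\<dots> = NE N m k E * (\<Sum>Y\<in>Conf2 N m. \<bar>g Y\<bar> * wt N m k Y)"
    by (subst sum_Conf2_shift) (simp add: NE_def sum_distrib_right)
  also have "\<dots> \<le> NE N m k E * (NF N m k g / 2)"
    by (intro mult_left_mono sum_wt_le_NF NE_nonneg)
  finally show ?thesis .
qed

text \<open>Stated for general \<open>g\<close> and \<open>q\<close> in order to serve both an image
  of the map and a difference of two images. \<open>E'\<close> contributes the hop sums at the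
  translates of \<open>M\<close>, with weights symmetric under \<open>n\<close> to
  \<open>- n\<close>, and \<open>f'\<close> those over \<open>Conf2\<close>; together they form one
  sum over \<open>Conf\<close>, to which \<open>Lap_bound\<close> applies.\<close>

lemma step_bound:
  assumes zero: "\<forall>n\<in>{1..<N}. g (shift N M (int n)) = 0"
    and E': "\<And>n. n \<in> {1..N} \<Longrightarrow> E' n = 2 * \<epsilon> * Lap N g (shift N M (- int n))"
    and f': "\<And>Y. Y \<in> Conf2 N m \<Longrightarrow>
      \<bar>f' Y\<bar> * (real (card (bdry N Y)) - 2) \<le> \<bar>\<epsilon>\<bar> * \<bar>Lap N g Y\<bar> + q Y / 2"
  shows "NE N m k E' + NF N m k f' \<le>
      2 * \<bar>\<epsilon>\<bar> * inverse k * (2 * \<bar>g M\<bar> + 3/2 * NF N m k g) + (\<Sum>Y\<in>Conf2 N m. q Y * wt N m k Y)"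
proof -
  have "NE N m k E' = (\<Sum>n=1..N. 2 * \<bar>\<epsilon>\<bar> * (\<bar>Lap N g (shift N M (- int n))\<bar> * wt N m k (shift N M (- int n))))"
    unfolding NE_def by (intro sum.cong refl) (simp add: E' wt_shift_neg abs_mult)
  moreover have "NF N m k f' \<le> (\<Sum>Y\<in>Conf2 N m. 2 * \<bar>\<epsilon>\<bar> * (\<bar>Lap N g Y\<bar> * wt N m k Y) + q Y * wt N m k Y)"
    unfolding NF_Conf2 sum_distrib_left
  proof (rule sum_mono)
    fix Y assume "Y \<in> Conf2 N m"
    from mult_right_mono[OF f'[OF this], of "2 * wt N m k Y"] wt_pos[of Y]
    show "2 * (\<bar>f' Y\<bar> * (real (card (bdry N Y)) - 2) * wt N m k Y) \<le>
         2 * \<bar>\<epsilon>\<bar> * (\<bar>Lap N g Y\<bar> * wt N m k Y) + q Y * wt N m k Y"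
      by (simp add: algebra_simps)
  qed
  ultimately have "NE N m k E' + NF N m k f' \<le> 2 * \<bar>\<epsilon>\<bar> * (\<Sum>Y\<in>Conf N m. \<bar>Lap N g Y\<bar> * wt N m k Y)
      + (\<Sum>Y\<in>Conf2 N m. q Y * wt N m k Y)"
    unfolding sum_Conf(2) by (simp add: sum.distrib sum_distrib_left algebra_simps)
  moreover have "2 * \<bar>\<epsilon>\<bar> * (\<Sum>Y\<in>Conf N m. \<bar>Lap N g Y\<bar> * wt N m k Y)
     \<le> 2 * \<bar>\<epsilon>\<bar> * (inverse k * (2 * \<bar>g M\<bar> + 3/2 * NF N m k g))"
  proof (rule mult_left_mono)
    have "inverse k * (\<Sum>Y\<in>Conf N m. real (card (bdry N Y)) * (\<bar>g Y\<bar> * wt N m k Y))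
        \<le> inverse k * (2 * \<bar>g M\<bar> + 3/2 * NF N m k g)"
      using sum_bdry_weight[OF zero] k_pos by (intro mult_left_mono) auto
    then show "(\<Sum>Y\<in>Conf N m. \<bar>Lap N g Y\<bar> * wt N m k Y) \<le> inverse k * (2 * \<bar>g M\<bar> + 3/2 * NF N m k g)"
      using Lap_bound[of g] by linarith
  qed simp
  ultimately show ?thesis by (simp add: mult.assoc)
qed

end

section \<open>The fixed point\<close>

text \<open>The starting point is the solution at zero coupling.\<close>

fun iterate :: "nat \<Rightarrow> nat \<Rightarrow> real \<Rightarrow> nat \<Rightarrow> (nat \<Rightarrow> real) \<times> (nat set \<Rightarrow> real)" where
  "iterate N m \<epsilon> 0 = (\<lambda>_. 0, \<lambda>Y. if Y = Mset m then 1 else 0)"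
| "iterate N m \<epsilon> (Suc p) = (stepE N m \<epsilon> (snd (iterate N m \<epsilon> p)),
      stepF N m \<epsilon> (fst (iterate N m \<epsilon> p)) (snd (iterate N m \<epsilon> p)))"

abbreviation itE :: "nat \<Rightarrow> nat \<Rightarrow> real \<Rightarrow> nat \<Rightarrow> nat \<Rightarrow> real" where
  "itE N m \<epsilon> p \<equiv> fst (iterate N m \<epsilon> p)"

abbreviation itF :: "nat \<Rightarrow> nat \<Rightarrow> real \<Rightarrow> nat \<Rightarrow> nat set \<Rightarrow> real" where
  "itF N m \<epsilon> p \<equiv> snd (iterate N m \<epsilon> p)"

lemma Lap_diff: "Lap N (\<lambda>Y. f Y - g Y) Z = Lap N f Z - Lap N g Z"
  by (simp add: Lap_def sum_subtractf)

lemma Conv_diff: "Conv N E f Y - Conv N E' f' Y =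
    Conv N (\<lambda>s. E s - E' s) f Y + Conv N E' (\<lambda>Y. f Y - f' Y) Y"
  unfolding Conv_def sum_subtractf[symmetric] sum.distrib[symmetric]
  by (intro sum.cong refl) (simp add: algebra_simps)

locale contraction_chain = weighted_chain +
  fixes \<epsilon> :: real
  assumes eps_small: "12 * \<bar>\<epsilon>\<bar> \<le> k"
begin

abbreviation norm1 :: "(nat \<Rightarrow> real) \<Rightarrow> (nat set \<Rightarrow> real) \<Rightarrow> real" where
  "norm1 E f \<equiv> NE N m k E + NF N m k f"

lemma eps_ratio: "2 * \<bar>\<epsilon>\<bar> * inverse k \<le> 1/6"
  using eps_small k_pos by (simp add: field_simps)

lemma stepF_normalised: "normalised N m (stepF N m \<epsilon> E f)"
  using M_notin_Conf2 shift_M_eq_M by (auto simp: normalised_def stepF_def)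

lemma stepF_Conf2: "Y \<in> Conf2 N m \<Longrightarrow>
    stepF N m \<epsilon> E f Y * (real (card (bdry N Y)) - 2) = - \<epsilon> * Lap N f Y + Conv N E f Y / 2"
proof -
  assume Y: "Y \<in> Conf2 N m"
  define d where "d = real (card (bdry N Y)) - 2"
  have "d \<noteq> 0" using Y by (simp add: d_def Conf2_def)
  moreover have "stepF N m \<epsilon> E f Y = - \<epsilon> / d * Lap N f Y + 1/2 * (1 / d) * Conv N E f Y"
    using Y M_notin_Conf2 by (auto simp: stepF_def d_def)
  ultimately show ?thesis unfolding d_def[symmetric] by (simp add: field_simps)
qed

lemma step_self_map:
  assumes "normalised N m f" "norm1 E f \<le> 1"
  shows "norm1 (stepE N m \<epsilon> f) (stepF N m \<epsilon> E f) \<le> 1"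
proof -
  have "norm1 (stepE N m \<epsilon> f) (stepF N m \<epsilon> E f)
      \<le> 2 * \<bar>\<epsilon>\<bar> * inverse k * (2 * \<bar>f M\<bar> + 3/2 * NF N m k f)
        + (\<Sum>Y\<in>Conf2 N m. \<bar>Conv N E f Y\<bar> * wt N m k Y)"
  proof (rule step_bound)
    fix Y assume Y: "Y \<in> Conf2 N m"
    then have pos: "real (card (bdry N Y)) - 2 > 0" by (simp add: Conf2_def)
    have "\<bar>stepF N m \<epsilon> E f Y\<bar> * (real (card (bdry N Y)) - 2) =
        \<bar>stepF N m \<epsilon> E f Y * (real (card (bdry N Y)) - 2)\<bar>" using pos by (simp add: abs_mult)
    also have "\<dots> \<le> \<bar>\<epsilon>\<bar> * \<bar>Lap N f Y\<bar> + \<bar>Conv N E f Y\<bar> / 2"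
      unfolding stepF_Conf2[OF Y] using abs_triangle_ineq[of "- \<epsilon> * Lap N f Y" "Conv N E f Y / 2"]
      by (simp add: abs_mult)
    finally show "\<bar>stepF N m \<epsilon> E f Y\<bar> * (real (card (bdry N Y)) - 2)
        \<le> \<bar>\<epsilon>\<bar> * \<bar>Lap N f Y\<bar> + \<bar>Conv N E f Y\<bar> / 2" .
  qed (use assms in \<open>auto simp: normalised_def stepE_def\<close>)
  \<comment> \<open>The linear part is at most 7/12, as \<open>f M = 1\<close>. Two nonnegative
    norms with sum at most 1 have product at most 1/4, so the quadratic part fits into the remaining
    5/12.\<close>
  also have "\<dots> \<le> 1/6 * (2 + 3/2) + 1 * (1/2) * (1/2)"
  proof (rule add_mono)
    have "2 * \<bar>f M\<bar> + 3/2 * NF N m k f \<le> 2 + 3/2"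
      using assms NE_nonneg[of E] by (simp add: normalised_def)
    moreover have "0 \<le> 2 * \<bar>f M\<bar> + 3/2 * NF N m k f" using NF_nonneg[of f] by simp
    ultimately show "2 * \<bar>\<epsilon>\<bar> * inverse k * (2 * \<bar>f M\<bar> + 3/2 * NF N m k f) \<le> 1/6 * (2 + 3/2)"
      using eps_ratio by (intro mult_mono) auto
    have "4 * (NE N m k E * NF N m k f) \<le> (norm1 E f)\<^sup>2"
      using sum_squares_bound[of "NE N m k E" "NF N m k f"] by (simp add: power2_sum)
    also have "\<dots> \<le> 1" using assms NE_nonneg[of E] NF_nonneg[of f] by (simp add: power_le_one)
    finally show "(\<Sum>Y\<in>Conf2 N m. \<bar>Conv N E f Y\<bar> * wt N m k Y) \<le> 1 * (1/2) * (1/2)"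
      using Conv_bound[of E f] by simp
  qed
  also have "\<dots> \<le> 1" by simp
  finally show ?thesis .
qed

lemma triangle: "\<bar>- \<epsilon> * l + (a + b) / 2\<bar> \<le> \<bar>\<epsilon>\<bar> * \<bar>l\<bar> + (\<bar>a\<bar> + \<bar>b\<bar>) / 2"
proof -
  have e: "\<bar>- \<epsilon> * l\<bar> = \<bar>\<epsilon>\<bar> * \<bar>l\<bar>" by (simp add: abs_mult)
  have "\<bar>- \<epsilon> * l + (a + b) / 2\<bar> \<le> \<bar>- \<epsilon> * l\<bar> + \<bar>(a + b) / 2\<bar>" by (rule abs_triangle_ineq)
  also have "\<bar>(a + b) / 2\<bar> \<le> (\<bar>a\<bar> + \<bar>b\<bar>) / 2"
    using abs_triangle_ineq[of a b] by simp
  finally show ?thesis unfolding e by simp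
qed

lemma step_contraction:
  assumes f: "normalised N m f" "norm1 E f \<le> 1" and f': "normalised N m f'" "norm1 E' f' \<le> 1"
  shows "norm1 (\<lambda>n. stepE N m \<epsilon> f n - stepE N m \<epsilon> f' n) (\<lambda>Y. stepF N m \<epsilon> E f Y - stepF N m \<epsilon> E' f' Y)
       \<le> 3/4 * norm1 (\<lambda>n. E n - E' n) (\<lambda>Y. f Y - f' Y)"
proof -
  let ?dE = "\<lambda>n. E n - E' n" and ?df = "\<lambda>Y. f Y - f' Y"
  let ?q = "\<lambda>Y. \<bar>Conv N ?dE f Y\<bar> + \<bar>Conv N E' ?df Y\<bar>"
  have "norm1 (\<lambda>n. stepE N m \<epsilon> f n - stepE N m \<epsilon> f' n) (\<lambda>Y. stepF N m \<epsilon> E f Y - stepF N m \<epsilon> E' f' Y)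
      \<le> 2 * \<bar>\<epsilon>\<bar> * inverse k * (2 * \<bar>?df M\<bar> + 3/2 * NF N m k ?df) + (\<Sum>Y\<in>Conf2 N m. ?q Y * wt N m k Y)"
  proof (rule step_bound)
    fix Y assume Y: "Y \<in> Conf2 N m"
    then have pos: "real (card (bdry N Y)) - 2 > 0" by (simp add: Conf2_def)
    have "\<bar>stepF N m \<epsilon> E f Y - stepF N m \<epsilon> E' f' Y\<bar> * (real (card (bdry N Y)) - 2) =
        \<bar>(stepF N m \<epsilon> E f Y - stepF N m \<epsilon> E' f' Y) * (real (card (bdry N Y)) - 2)\<bar>"
      using pos by (simp add: abs_mult)
    also have "(stepF N m \<epsilon> E f Y - stepF N m \<epsilon> E' f' Y) * (real (card (bdry N Y)) - 2)
       = - \<epsilon> * Lap N ?df Y + (Conv N E f Y - Conv N E' f' Y) / 2"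
      using stepF_Conf2[OF Y, of E f] stepF_Conf2[OF Y, of E' f'] by (simp add: Lap_diff algebra_simps diff_divide_distrib)
    also have "\<bar>\<dots>\<bar> \<le> \<bar>\<epsilon>\<bar> * \<bar>Lap N ?df Y\<bar> + ?q Y / 2"
      unfolding Conv_diff by (rule triangle)
    finally show "\<bar>stepF N m \<epsilon> E f Y - stepF N m \<epsilon> E' f' Y\<bar> * (real (card (bdry N Y)) - 2)
        \<le> \<bar>\<epsilon>\<bar> * \<bar>Lap N ?df Y\<bar> + ?q Y / 2" .
  qed (use f f' in \<open>auto simp: normalised_def stepE_def Lap_diff algebra_simps\<close>)
  \<comment> \<open>Two normalised functions agree at \<open>M\<close>, so the inhomogeneous term
    drops out and the linear part contracts by \<open>1/6 * 3/2 = 1/4\<close>. The bilinear part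
    adds at most half of each norm, which gives 3/4 in total.\<close>
  also have "2 * \<bar>\<epsilon>\<bar> * inverse k * (2 * \<bar>?df M\<bar> + 3/2 * NF N m k ?df) \<le> 1/6 * (3/2 * NF N m k ?df)"
    using f f' NF_nonneg[of ?df] by (intro mult_mono eps_ratio) (auto simp: normalised_def)
  also have "(\<Sum>Y\<in>Conf2 N m. ?q Y * wt N m k Y) \<le> NE N m k ?dE / 2 + NF N m k ?df / 2"
  proof -
    have a: "NE N m k ?dE * NF N m k f \<le> NE N m k ?dE * 1"
      using f NE_nonneg[of E] NE_nonneg[of ?dE] by (intro mult_left_mono) auto
    have b: "NE N m k E' * NF N m k ?df \<le> 1 * NF N m k ?df"
      using f' NF_nonneg[of f'] NF_nonneg[of ?df] by (intro mult_right_mono) auto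
    have "(\<Sum>Y\<in>Conf2 N m. ?q Y * wt N m k Y) = (\<Sum>Y\<in>Conf2 N m. \<bar>Conv N ?dE f Y\<bar> * wt N m k Y)
        + (\<Sum>Y\<in>Conf2 N m. \<bar>Conv N E' ?df Y\<bar> * wt N m k Y)"
      by (simp add: distrib_right sum.distrib)
    then show ?thesis using Conv_bound[of ?dE f] Conv_bound[of E' ?df] a b by simp
  qed
  also have "1/6 * (3/2 * NF N m k ?df) + (NE N m k ?dE / 2 + NF N m k ?df / 2) \<le> 3/4 * norm1 ?dE ?df"
    using NE_nonneg[of ?dE] by simp
  finally show ?thesis by simp
qed

lemma NF_zero: "(\<And>Y. Y \<in> Conf2 N m \<Longrightarrow> f Y = 0) \<Longrightarrow> NF N m k f = 0"
  by (simp add: NF_Conf2)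

lemma NE_cong: "(\<And>n. n \<in> {1..N} \<Longrightarrow> E n = E' n) \<Longrightarrow> NE N m k E = NE N m k E'"
  unfolding NE_def by (rule sum.cong) auto

lemma NF_cong: "(\<And>Y. Y \<in> Conf2 N m \<Longrightarrow> f Y = f' Y) \<Longrightarrow> NF N m k f = NF N m k f'"
  unfolding NF_Conf2 by simp

lemma iterate_normalised: "normalised N m (itF N m \<epsilon> p)"
proof (cases p)
  case 0
  then show ?thesis using shift_M_eq_M by (simp add: normalised_def)
next
  case (Suc q)
  then show ?thesis using stepF_normalised by simp
qed

lemma iterate_norm: "norm1 (itE N m \<epsilon> p) (itF N m \<epsilon> p) \<le> 1"
proof (induction p)
  case 0
  have "NF N m k (\<lambda>Y. if Y = M then 1 else 0) = 0"
    using M_notin_Conf2 by (intro NF_zero) auto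
  then show ?case by (simp add: NE_def)
next
  case (Suc p)
  then show ?case using step_self_map iterate_normalised by simp
qed

lemma norm1_diff_le:
  assumes "norm1 E f \<le> 1" "norm1 E' f' \<le> 1"
  shows "norm1 (\<lambda>n. E n - E' n) (\<lambda>Y. f Y - f' Y) \<le> 2"
  using NE_diff[of E E'] NF_diff[of f f'] assms by linarith

lemma iterate_close:
  assumes fp: "conf_fp N m \<epsilon> E f" and le: "norm1 E f \<le> 1"
  shows "norm1 (\<lambda>n. itE N m \<epsilon> p n - E n) (\<lambda>Y. itF N m \<epsilon> p Y - f Y) \<le> 2 * (3/4) ^ p"
proof (induction p)
  case 0
  then show ?case using norm1_diff_le[OF iterate_norm[of 0] le] by simp
next
  case (Suc p)
  have "norm1 (\<lambda>n. itE N m \<epsilon> (Suc p) n - E n) (\<lambda>Y. itF N m \<epsilon> (Suc p) Y - f Y)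
      = norm1 (\<lambda>n. stepE N m \<epsilon> (itF N m \<epsilon> p) n - stepE N m \<epsilon> f n)
          (\<lambda>Y. stepF N m \<epsilon> (itE N m \<epsilon> p) (itF N m \<epsilon> p) Y - stepF N m \<epsilon> E f Y)"
    using fp by (intro arg_cong2[where f = "(+)"] NE_cong NF_cong) (auto simp: conf_fp_def)
  also have "\<dots> \<le> 3/4 * norm1 (\<lambda>n. itE N m \<epsilon> p n - E n) (\<lambda>Y. itF N m \<epsilon> p Y - f Y)"
    using fp le by (intro step_contraction iterate_normalised iterate_norm) (auto simp: conf_fp_def)
  finally show ?case using Suc by simp
qed

lemma iterate_Cauchy:
  "norm1 (\<lambda>n. itE N m \<epsilon> (Suc p) n - itE N m \<epsilon> p n) (\<lambda>Y. itF N m \<epsilon> (Suc p) Y - itF N m \<epsilon> p Y)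
     \<le> 2 * (3/4) ^ p"
proof (induction p)
  case 0
  then show ?case using norm1_diff_le[OF iterate_norm[of 1] iterate_norm[of 0]] by simp
next
  case (Suc p)
  have "norm1 (\<lambda>n. itE N m \<epsilon> (Suc (Suc p)) n - itE N m \<epsilon> (Suc p) n)
          (\<lambda>Y. itF N m \<epsilon> (Suc (Suc p)) Y - itF N m \<epsilon> (Suc p) Y)
      \<le> 3/4 * norm1 (\<lambda>n. itE N m \<epsilon> (Suc p) n - itE N m \<epsilon> p n) (\<lambda>Y. itF N m \<epsilon> (Suc p) Y - itF N m \<epsilon> p Y)"
    using step_contraction[OF iterate_normalised[of "Suc p"] iterate_norm[of "Suc p"]
        iterate_normalised[of p] iterate_norm[of p]] by simp
  then show ?case using Suc by simp
qed

end

lemma geometric_steps_convergent: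
  fixes a :: "nat \<Rightarrow> real"
  assumes "\<And>p. \<bar>a (Suc p) - a p\<bar> \<le> C * c ^ p" "0 \<le> c" "c < 1"
  shows "convergent a"
proof -
  have "summable (\<lambda>p. a (Suc p) - a p)"
    by (rule summable_comparison_test[of _ "\<lambda>p. C * c ^ p"])
      (use assms in \<open>auto intro!: summable_mult summable_geometric\<close>)
  then have "convergent (\<lambda>n. a n - a 0)"
    by (simp add: summable_iff_convergent sum_lessThan_telescope)
  then have "convergent (\<lambda>n. (a n - a 0) + a 0)"
    by (intro convergent_add convergent_const)
  then show ?thesis by simp
qed

context contraction_chain
begin

lemma itF_outside: "Y \<notin> Conf2 N m \<Longrightarrow> itF N m \<epsilon> p Y = (if Y = M then 1 else 0)"
  by (cases p) (auto simp: stepF_def)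

lemma iterate_limit:
  "\<exists>E f. (\<forall>n\<in>{1..N}. (\<lambda>p. itE N m \<epsilon> p n) \<longlonglongrightarrow> E n) \<and> (\<forall>Y. (\<lambda>p. itF N m \<epsilon> p Y) \<longlonglongrightarrow> f Y)"
proof -
  have cE: "convergent (\<lambda>p. itE N m \<epsilon> p n)" if n: "n \<in> {1..N}" for n
  proof (rule geometric_steps_convergent[of _ 2 "3/4"])
    fix p
    show "\<bar>itE N m \<epsilon> (Suc p) n - itE N m \<epsilon> p n\<bar> \<le> 2 * (3/4) ^ p"
      using NE_coord1[OF n, of "\<lambda>n. itE N m \<epsilon> (Suc p) n - itE N m \<epsilon> p n"] iterate_Cauchy[of p]
        NF_nonneg[of "\<lambda>Y. itF N m \<epsilon> (Suc p) Y - itF N m \<epsilon> p Y"] by linarith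
  qed auto
  have cF: "convergent (\<lambda>p. itF N m \<epsilon> p Y)" for Y
  proof (cases "Y \<in> Conf2 N m")
    case True
    show ?thesis
    proof (rule geometric_steps_convergent[of _ 2 "3/4"])
      fix p
      show "\<bar>itF N m \<epsilon> (Suc p) Y - itF N m \<epsilon> p Y\<bar> \<le> 2 * (3/4) ^ p"
        using NF_coord[OF True, of "\<lambda>Y. itF N m \<epsilon> (Suc p) Y - itF N m \<epsilon> p Y"] iterate_Cauchy[of p]
          NF_nonneg[of "\<lambda>Y. itF N m \<epsilon> (Suc p) Y - itF N m \<epsilon> p Y"]
          NE_nonneg[of "\<lambda>n. itE N m \<epsilon> (Suc p) n - itE N m \<epsilon> p n"] by linarith
    qed auto
  next
    case False
    then show ?thesis by (simp add: itF_outside convergent_const)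
  qed
  show ?thesis using cE cF unfolding convergent_def by metis
qed

text \<open>Convergence of each coordinate suffices: for fixed \<open>N\<close> the map and the norm
  are built from finite sums, so the limit passes through the equation and through the
  bound.\<close>

lemma fp_exists: "\<exists>E f. conf_fp N m \<epsilon> E f \<and> norm1 E f \<le> 1"
proof -
  obtain E f where E: "\<And>n. n \<in> {1..N} \<Longrightarrow> (\<lambda>p. itE N m \<epsilon> p n) \<longlonglongrightarrow> E n"
    and f: "\<And>Y. (\<lambda>p. itF N m \<epsilon> p Y) \<longlonglongrightarrow> f Y" using iterate_limit by blast
  have lap: "(\<lambda>p. Lap N (itF N m \<epsilon> p) Y) \<longlonglongrightarrow> Lap N f Y" for Y
    unfolding Lap_def by (intro tendsto_sum f)
  have conv: "(\<lambda>p. Conv N (itE N m \<epsilon> p) (itF N m \<epsilon> p) Y) \<longlonglongrightarrow> Conv N E f Y" for Y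
    unfolding Conv_def by (intro tendsto_sum tendsto_mult f E)
  have "E n = stepE N m \<epsilon> f n" if "n \<in> {1..N}" for n
  proof (rule LIMSEQ_unique)
    show "(\<lambda>p. itE N m \<epsilon> (Suc p) n) \<longlonglongrightarrow> E n" using E[OF that] by (rule LIMSEQ_Suc)
    show "(\<lambda>p. itE N m \<epsilon> (Suc p) n) \<longlonglongrightarrow> stepE N m \<epsilon> f n"
      unfolding iterate.simps fst_conv stepE_def by (intro tendsto_mult tendsto_const lap)
  qed
  moreover have "f Y = stepF N m \<epsilon> E f Y" for Y
  proof (rule LIMSEQ_unique)
    show "(\<lambda>p. itF N m \<epsilon> (Suc p) Y) \<longlonglongrightarrow> f Y" using f by (rule LIMSEQ_Suc)
    show "(\<lambda>p. itF N m \<epsilon> (Suc p) Y) \<longlonglongrightarrow> stepF N m \<epsilon> E f Y"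
      unfolding iterate.simps snd_conv stepF_def
      by (auto simp: Conf2_def intro!: tendsto_intros lap conv)
  qed
  moreover have "normalised N m f"
    using stepF_normalised[of E f] calculation(2) by (simp add: normalised_def)
  moreover have "norm1 E f \<le> 1"
  proof (rule LIMSEQ_le_const2)
    show "(\<lambda>p. norm1 (itE N m \<epsilon> p) (itF N m \<epsilon> p)) \<longlonglongrightarrow> norm1 E f"
      unfolding NE_def NF_def
      by (intro tendsto_add tendsto_sum tendsto_mult tendsto_rabs tendsto_const E f)
  qed (use iterate_norm in auto)
  ultimately show ?thesis unfolding conf_fp_def by blast
qed

lemma itF_le1: "\<bar>itF N m \<epsilon> p Y\<bar> \<le> 1"
proof (cases "Y \<in> Conf2 N m")
  case True
  then show ?thesis
    using NF_coord[OF True, of "itF N m \<epsilon> p"] iterate_norm[of p] NE_nonneg[of "itE N m \<epsilon> p"]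
      NF_nonneg[of "itF N m \<epsilon> p"] by linarith
next
  case False
  then show ?thesis by (simp add: itF_outside)
qed

text \<open>This is where the weights pay off: membership in the unit ball makes \<open>E n\<close>
  small with the distance of the \<open>n\<close>-th translate from \<open>M\<close>, which later
  yields summability in \<open>n\<close> and the order of the coefficients.\<close>

lemma NE_le1_coord:
  assumes "NE N m k E \<le> 1" "n \<in> {1..N}"
  shows "\<bar>E n\<bar> \<le> k ^ dst N m (shift N M (int n))"
proof -
  have "\<bar>E n\<bar> * inverse (k ^ dst N m (shift N M (int n))) \<le> 1"
    using NE_coord[OF assms(2), of E] assms(1) unfolding wt_def by linarith
  then show ?thesis using k_pos by (simp add: field_simps)
qed

lemma itE_le: "n \<in> {1..N} \<Longrightarrow> \<bar>itE N m \<epsilon> p n\<bar> \<le> k ^ dst N m (shift N M (int n))"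
  using iterate_norm[of p] NF_nonneg[of "itF N m \<epsilon> p"] by (intro NE_le1_coord) auto

end

section \<open>Eigenvectors and the spectral gap\<close>

definition wave :: "nat \<Rightarrow> nat \<Rightarrow> int \<Rightarrow> complex" where
  "wave N j x = exp (\<i> * of_real (2 * pi * real j / real N) * of_int x)"

lemma wave_add: "wave N j (x + y) = wave N j x * wave N j y"
  unfolding wave_def of_int_add distrib_left exp_add ..

lemma wave_N: "N > 0 \<Longrightarrow> wave N j (int N * t) = 1"
proof -
  assume "N > 0"
  then have "wave N j (int N * t) = exp ((2 * of_int (int j * t) * pi) * \<i>)"
    unfolding wave_def by (intro arg_cong[where f = exp]) (simp add: field_simps)
  then show ?thesis by (metis Ints_of_int exp_integer_2pi)
qed

lemma wave_cong: "N > 0 \<Longrightarrow> x mod int N = y mod int N \<Longrightarrow> wave N j x = wave N j y"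
proof -
  assume N: "N > 0" and "x mod int N = y mod int N"
  then obtain t where "x = y + int N * t" by (metis mod_eqE add.commute mult.commute diff_add_cancel mod_eq_dvd_iff dvd_def)
  then show ?thesis using N by (simp add: wave_add wave_N)
qed

lemma wave_orthogonal:
  assumes "N > 0"
  shows "(\<Sum>j<N. wave N j x) = (if x mod int N = 0 then of_nat N else 0)"
proof -
  define z where "z = wave N 1 x"
  have pow: "wave N j x = z ^ j" for j
    unfolding z_def wave_def exp_of_nat_mult[symmetric]
    by (intro arg_cong[where f = exp]) (simp add: field_simps)
  show ?thesis
  proof (cases "x mod int N = 0")
    case True
    then have "z = 1" using wave_cong[OF assms, of x 0 1] by (simp add: z_def) (simp add: wave_def)
    then show ?thesis using True by (simp add: pow)
  next
    case False
    have "z \<noteq> 1"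
    proof
      assume "z = 1"
      then obtain t :: int where "Im (\<i> * of_real (2 * pi * real 1 / real N) * of_int x) = of_int (2 * t) * pi"
        unfolding z_def wave_def exp_eq_1 by blast
      then have "2 * pi * real_of_int x / real N = 2 * pi * of_int t" by (simp add: mult_ac)
      then have "real_of_int x = of_int (t * int N)" using assms by (simp add: field_simps)
      then have "x = t * int N" by linarith
      then show False using False by simp
    qed
    moreover have "z ^ N = 1"
      using wave_N[OF assms, of 1 x] pow unfolding z_def wave_def exp_of_nat_mult[symmetric]
      by (simp add: mult_ac)
    ultimately show ?thesis using False by (simp add: pow geometric_sum)
  qed
qed

lemma mod_diff_zero_iff:
  assumes "a \<in> {1..N}" "b \<in> {1..N}"
  shows "(int a - int b) mod int N = 0 \<longleftrightarrow> a = b"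
proof
  assume "(int a - int b) mod int N = 0"
  then have "int N dvd int a - int b" by presburger
  then have "int a - int b = 0" using assms dvd_imp_le_int[of "int a - int b" "int N"] by fastforce
  then show "a = b" by simp
qed simp

lemma sum_periodic_shift:
  fixes h :: "int \<Rightarrow> complex"
  assumes N: "N > 0" and per: "\<And>x y. x mod int N = y mod int N \<Longrightarrow> h x = h y"
  shows "(\<Sum>l=1..N. h (int l + a)) = (\<Sum>l=1..N. h (int l))"
proof -
  have *: "(\<Sum>l=1..N. g (int l)) = (\<Sum>l=0..<N. g (int l))"
    if g: "\<And>x y. x mod int N = y mod int N \<Longrightarrow> g x = g y" for g :: "int \<Rightarrow> complex"
  proof -
    have "{1..N} = insert N {1..<N}" "{0..<N} = insert 0 {1..<N}" using N by auto
    moreover have "g (int N) = g (int 0)" by (rule g) simp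
    ultimately show ?thesis by simp
  qed
  have "bij_betw (rot N a) {0..<N} {0..<N}"
    by (rule bij_betw_byWitness[of _ "rot N (- a)"]) (auto simp: rot_inverse rot_less N)
  from sum.reindex_bij_betw[OF this, of "\<lambda>l. h (int l)"]
  have "(\<Sum>l=0..<N. h (int (rot N a l))) = (\<Sum>l=0..<N. h (int l))" .
  moreover have "h (int (rot N a l)) = h (int l + a)" for l
    by (rule per) (simp add: int_rot N)
  ultimately have eq: "(\<Sum>l=0..<N. h (int l + a)) = (\<Sum>l=0..<N. h (int l))" by simp
  have "h (x + a) = h (y + a)" if "x mod int N = y mod int N" for x y
    using that by (intro per) (metis mod_add_cong)
  then have "(\<Sum>l=1..N. h (int l + a)) = (\<Sum>l=0..<N. h (int l + a))"
    by (rule *)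
  moreover have "(\<Sum>l=1..N. h (int l)) = (\<Sum>l=0..<N. h (int l))"
    by (rule *) (rule per)
  ultimately show ?thesis using eq by (simp only:)
qed

lemma rep_mod: "s \<le> N \<Longrightarrow> rep N s mod int N = int s mod int N"
  by (simp add: rep_def)

text \<open>The amplitude of \<open>psi\<close> at \<open>Y\<close>: for each \<open>l\<close>
  exactly one configuration is translated to \<open>Y\<close>. It is defined on all sets, so that
  translation identities hold without a support condition.\<close>

definition mode :: "nat \<Rightarrow> nat \<Rightarrow> (nat set \<Rightarrow> real) \<Rightarrow> nat set \<Rightarrow> complex" where
  "mode N j f Y = (\<Sum>l=1..N. wave N j (int l) * of_real (f (shift N Y (- int l))))"

context chain
begin

lemma psi_eq:
  "psi N m e (2 * pi * real j / real N) Y =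
     (if Y \<in> Conf N m then mode N j (\<lambda>Y. e (symd Y M)) Y else 0)"
proof -
  let ?f = "\<lambda>Y. e (symd Y M)"
  have "psi N m e (2 * pi * real j / real N) Y = (\<Sum>l=1..N. \<Sum>Z\<in>Conf N m.
      if shift N Z (int l) = Y then wave N j (int l) * of_real (?f Z) else 0)"
    unfolding psi_def
    by (intro sum.cong[OF refl] sum.reindex_bij_witness[of _ "\<lambda>Y. symd Y M" "\<lambda>Y. symd Y M"])
      (auto simp: Conf_def Xset_def wave_def symd_subset M_subset)
  also have "\<dots> = (if Y \<in> Conf N m then mode N j ?f Y else 0)"
  proof (cases "Y \<in> Conf N m")
    case True
    have "shift N Z (int l) = Y \<longleftrightarrow> Z = shift N Y (- int l)" if "Z \<in> Conf N m" for Z l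
      using that True by (auto simp: shift_shift N0 shift_0 ConfD)
    then have "(\<Sum>Z\<in>Conf N m. if shift N Z (int l) = Y then wave N j (int l) * of_real (?f Z) else 0)
       = (\<Sum>Z\<in>Conf N m. if Z = shift N Y (- int l) then wave N j (int l) * of_real (?f Z) else 0)" for l
      by (intro sum.cong) auto
    then show ?thesis using True by (simp add: mode_def Conf_shift N0)
  next
    case False
    then have "shift N Z l \<noteq> Y" if "Z \<in> Conf N m" for Z l
      using that Conf_shift N0 by metis
    then show ?thesis using False by (auto intro!: sum.neutral)
  qed
  finally show ?thesis .
qed

lemma wave_shift_periodic:
  assumes "x mod int N = y mod int N"
  shows "wave N j x * of_real (f (shift N Y (- x))) = wave N j y * of_real (f (shift N Y (- y)))"
proof -
  have "(- x) mod int N = (- y) mod int N" using assms by (metis mod_minus_cong)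
  then show ?thesis using wave_cong[OF N0 assms] shift_cong by metis
qed

text \<open>Reindexing the sum over a full period pulls out a phase. With \<open>a = - 1\<close> it
  gives the eigenvalue of the translation operator; summed against \<open>E\<close> it gives the
  energy.\<close>

lemma mode_shift: "mode N j f (shift N Y a) = wave N j a * mode N j f Y"
proof -
  let ?h = "\<lambda>x. wave N j x * complex_of_real (f (shift N Y (- x)))"
  have "mode N j f (shift N Y a) = (\<Sum>l=1..N. wave N j a * ?h (int l + (- a)))"
    unfolding mode_def
  proof (rule sum.cong[OF refl])
    fix l :: nat
    have "wave N j (int l) = wave N j a * wave N j (int l - a)" by (simp flip: wave_add)
    then show "wave N j (int l) * complex_of_real (f (shift N (shift N Y a) (- int l))) =
        wave N j a * ?h (int l + (- a))"
      by (simp add: shift_shift N0)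
  qed
  also have "\<dots> = wave N j a * (\<Sum>l=1..N. ?h (int l + (- a)))"
    by (rule sum_distrib_left[symmetric])
  also have "(\<Sum>l=1..N. ?h (int l + (- a))) = (\<Sum>l=1..N. ?h (int l))"
    by (rule sum_periodic_shift[OF N0, of ?h]) (rule wave_shift_periodic)
  finally show ?thesis by (simp add: mode_def)
qed

lemma normalised_shift:
  assumes "normalised N m f"
  shows "f (shift N M x) = (if x mod int N = 0 then 1 else 0)"
proof -
  obtain n where n: "n \<in> {1..N}" "shift N M x = shift N M (int n)" using shift_reduce by blast
  have xn: "x mod int N = int n mod int N" using shift_M_inj n by blast
  show ?thesis
  proof (cases "n = N")
    case True
    then show ?thesis using assms n xn by (simp add: shift_M_N normalised_def)
  next
    case False
    then show ?thesis using assms n xn by (simp add: normalised_def)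
  qed
qed

text \<open>Normalisation kills every term but \<open>l = N\<close>. Consequently the Bloch state
  does not vanish.\<close>

lemma mode_M:
  assumes "normalised N m f"
  shows "mode N j f M = 1"
proof -
  have "mode N j f M = (\<Sum>l=1..N. if l = N then 1 else 0)"
    unfolding mode_def
  proof (rule sum.cong[OF refl])
    fix l assume l: "l \<in> {1..N}"
    have "(- int l) mod int N = 0 \<longleftrightarrow> l = N"
      using mod_diff_zero_iff[of N N l] l N0 by auto
    then show "wave N j (int l) * complex_of_real (f (shift N M (- int l))) = (if l = N then 1 else 0)"
      using wave_N[OF N0, of j 1] by (simp add: normalised_shift[OF assms])
  qed
  then show ?thesis using N0 by simp
qed

text \<open>With denominators cleared, the equations on \<open>Conf2\<close> and on the translates
  of \<open>M\<close> take one common form. The hop term carries \<open>+ 2 * \<epsilon>\<close>,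
  whereas \<open>ham\<close> subtracts it; hence the states belong to
  \<open>ham N (- \<epsilon>)\<close>. The 4 is the diagonal energy of \<open>M\<close>, twice its
  two boundary bonds.\<close>

lemma eigen_local:
  assumes fp: "conf_fp N m \<epsilon> E f" and Z: "Z \<in> Conf N m"
  shows "2 * real (card (bdry N Z)) * f Z + 2 * \<epsilon> * Lap N f Z = 4 * f Z + Conv N E f Z"
proof (cases "Z \<in> Conf2 N m")
  case True
  define d where "d = real (card (bdry N Z)) - 2"
  have "d \<noteq> 0" using True by (simp add: d_def Conf2_def)
  moreover have "f Z = - \<epsilon> / d * Lap N f Z + 1/2 * (1 / d) * Conv N E f Z"
    using True M_notin_Conf2 fp by (auto simp: conf_fp_def stepF_def d_def)
  ultimately have "2 * d * f Z = - 2 * \<epsilon> * Lap N f Z + Conv N E f Z" by (simp add: field_simps)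
  then show ?thesis by (simp add: d_def algebra_simps)
next
  case False
  then obtain n where n: "n \<in> {1..N}" "Z = shift N M (- int n)"
    using Z Conf_eq(2) by auto
  have "Conv N E f Z = (\<Sum>s=1..N. if s = n then E s else 0)"
    unfolding Conv_def
  proof (rule sum.cong[OF refl])
    fix s assume s: "s \<in> {1..N}"
    have "(int s - int n) mod int N = 0 \<longleftrightarrow> s = n"
      using s n by (intro mod_diff_zero_iff) auto
    then show "E s * f (shift N Z (int s)) = (if s = n then E s else 0)"
      using fp n by (auto simp: conf_fp_def shift_shift N0 normalised_shift)
  qed
  also have "\<dots> = 2 * \<epsilon> * Lap N f Z" using n fp by (simp add: conf_fp_def stepE_def)
  finally show ?thesis using n by (simp add: card_bdry_shift_M)
qed

text \<open>The Fourier transform turns convolution with \<open>E\<close> into multiplication by the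
  dispersion, with \<open>mode_shift\<close> applied to each term.\<close>

lemma mode_Conv:
  "(\<Sum>l=1..N. wave N j (int l) * of_real (Conv N E f (shift N Y (- int l))))
     = (\<Sum>s=1..N. of_real (E s) * wave N j (int s)) * mode N j f Y"
proof -
  have inner: "(\<Sum>l=1..N. wave N j (int l) * of_real (f (shift N (shift N Y (int s)) (- int l))))
      = wave N j (int s) * mode N j f Y" for s
    using mode_shift[of j f Y "int s"] by (simp only: mode_def)
  have "(\<Sum>l=1..N. wave N j (int l) * complex_of_real (Conv N E f (shift N Y (- int l))))
     = (\<Sum>s=1..N. of_real (E s) * (\<Sum>l=1..N. wave N j (int l) * of_real (f (shift N (shift N Y (int s)) (- int l)))))"
    unfolding Conv_def of_real_sum sum_distrib_left
    by (subst sum.swap) (simp add: shift_shift N0 algebra_simps)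
  also have "\<dots> = (\<Sum>s=1..N. of_real (E s) * (wave N j (int s) * mode N j f Y))"
    by (simp only: inner)
  finally show ?thesis by (simp add: sum_distrib_right mult.assoc)
qed

text \<open>At the momenta of the ring, phases are periodic modulo \<open>N\<close>, so the centred
  representative \<open>rep N s\<close> gives the same phase as \<open>s\<close>; the choice only
  affects momenta in between.\<close>

lemma EN_eq: "EN N E (2 * pi * real j / real N) = 4 + (\<Sum>s=1..N. of_real (E s) * wave N j (int s))"
proof -
  have "exp (\<i> * complex_of_real (2 * pi * real j / real N) * of_int (rep N s)) = wave N j (int s)"
    if "s \<in> {1..N}" for s
    using wave_cong[OF N0 rep_mod, of s j] that by (simp add: wave_def)
  then show ?thesis unfolding EN_def by simp
qed

lemma mode_eigen:
  assumes fp: "conf_fp N m \<epsilon> E f" and Y: "Y \<in> Conf N m"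
  shows "2 * of_nat (card (bdry N Y)) * mode N j f Y
       + 2 * of_real \<epsilon> * (\<Sum>i\<in>bdry N Y. mode N j f (symd Y (bond N i)))
     = EN N E (2 * pi * real j / real N) * mode N j f Y"
proof -
  have Ys: "Y \<subseteq> {0..<N}" using Y by (rule ConfD)
  have "(\<Sum>i\<in>bdry N Y. mode N j f (symd Y (bond N i))) =
     (\<Sum>l=1..N. wave N j (int l) * of_real (Lap N f (shift N Y (- int l))))"
    unfolding mode_def Lap_def sum_bdry_shift[OF Ys]
    by (subst sum.swap) (simp add: sum_distrib_left)
  then have "2 * of_nat (card (bdry N Y)) * mode N j f Y
       + 2 * of_real \<epsilon> * (\<Sum>i\<in>bdry N Y. mode N j f (symd Y (bond N i)))
    = (\<Sum>l=1..N. wave N j (int l) * of_real (2 * real (card (bdry N (shift N Y (- int l)))) * f (shift N Y (- int l))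
         + 2 * \<epsilon> * Lap N f (shift N Y (- int l))))"
    by (simp add: mode_def sum_distrib_left sum.distrib card_bdry_shift[OF Ys] algebra_simps)
  also have "\<dots> = (\<Sum>l=1..N. wave N j (int l) * of_real (4 * f (shift N Y (- int l)) + Conv N E f (shift N Y (- int l))))"
    by (simp only: eigen_local[OF fp Conf_shift[OF N0 Y]])
  also have "\<dots> = 4 * mode N j f Y + (\<Sum>l=1..N. wave N j (int l) * of_real (Conv N E f (shift N Y (- int l))))"
    by (simp add: mode_def sum_distrib_left sum.distrib algebra_simps)
  finally show ?thesis by (simp only: mode_Conv EN_eq distrib_right)
qed

lemma psi_eigenstate:
  assumes fp: "conf_fp N m \<epsilon> es (\<lambda>Y. e (symd Y M))"
  shows "psi N m e (2 * pi * real j / real N) \<noteq> (\<lambda>_. 0)"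
    and "in_sector N m (psi N m e (2 * pi * real j / real N))"
    and "transl N (psi N m e (2 * pi * real j / real N))
       = (\<lambda>Y. exp (- \<i> * of_real (2 * pi * real j / real N)) * psi N m e (2 * pi * real j / real N) Y)"
    and "ham N (- \<epsilon>) (psi N m e (2 * pi * real j / real N))
       = (\<lambda>Y. EN N es (2 * pi * real j / real N) * psi N m e (2 * pi * real j / real N) Y)"
proof -
  let ?f = "\<lambda>Y. e (symd Y M)" and ?psi = "psi N m e (2 * pi * real j / real N)"
  have "?psi M = 1"
    unfolding psi_eq using M_Conf mode_M[of ?f j] fp by (simp add: conf_fp_def)
  then show "?psi \<noteq> (\<lambda>_. 0)" by (metis zero_neq_one)
  show "in_sector N m ?psi"
    unfolding in_sector_def psi_eq by (auto simp: Conf_def split: if_splits)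
  show "transl N ?psi = (\<lambda>Y. exp (- \<i> * of_real (2 * pi * real j / real N)) * ?psi Y)"
  proof (rule ext)
    fix Y
    have "exp (- \<i> * of_real (2 * pi * real j / real N)) = wave N j (- 1)" by (simp add: wave_def)
    moreover have "shift N Y (- 1) \<in> Conf N m \<longleftrightarrow> Y \<in> Conf N m" if "Y \<subseteq> {0..<N}"
      using that by (simp add: Conf_def shift_subset N0 card_shift)
    ultimately show "transl N ?psi Y = exp (- \<i> * of_real (2 * pi * real j / real N)) * ?psi Y"
      unfolding transl_def psi_eq using mode_shift[of j ?f Y "- 1"] by (auto simp: Conf_def)
  qed
  show "ham N (- \<epsilon>) ?psi = (\<lambda>Y. EN N es (2 * pi * real j / real N) * ?psi Y)"
  proof (rule ext)
    fix Y
    show "ham N (- \<epsilon>) ?psi Y = EN N es (2 * pi * real j / real N) * ?psi Y"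
    proof (cases "Y \<in> Conf N m")
      case True
      have "(\<Sum>i\<in>bdry N Y. ?psi (symd Y (bond N i))) = (\<Sum>i\<in>bdry N Y. mode N j ?f (symd Y (bond N i)))"
        by (intro sum.cong refl) (simp add: psi_eq Conf_symd_bond[OF N1 True])
      then show ?thesis
        using True mode_eigen[OF fp True, of j] ConfD(1)[OF True] by (simp add: ham_def psi_eq)
    next
      case False
      \<comment> \<open>Hops preserve the number of down spins, so outside the sector both sides
        vanish.\<close>
      have "symd Y (bond N i) \<notin> Conf N m" if "Y \<subseteq> {0..<N}" "i \<in> bdry N Y" for i
        using False that card_symd_bond[OF N1 that(2)] finite_subset[OF that(1)] by (auto simp: Conf_def)
      then show ?thesis using False by (simp add: ham_def psi_eq)
    qed
  qed
qed

text \<open>Inverse discrete Fourier transform: orthogonality to the Bloch states of all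
  \<open>N\<close> momenta implies orthogonality to each translate of the localised state with
  amplitudes \<open>e (symd Z M)\<close>.\<close>

lemma orthogonal_translates:
  assumes v: "in_sector N m v"
    and orth: "\<forall>j<N. (\<Sum>Y\<in>Pow {0..<N}. cnj (psi N m e (2 * pi * real j / real N) Y) * v Y) = 0"
    and l: "l \<in> {1..N}"
  shows "(\<Sum>Z\<in>Conf N m. of_real (e (symd Z M)) * v (shift N Z (int l))) = 0"
proof -
  let ?f = "\<lambda>Y. e (symd Y M)"
  define G where "G x = (\<Sum>Y\<in>Conf N m. of_real (?f (shift N Y (- x))) * v Y)" for x
  have zero: "(\<Sum>i=1..N. wave N j (- int i) * G (int i)) = 0" if "j < N" for j
  proof -
    have "0 = (\<Sum>Y\<in>Pow {0..<N}. cnj (psi N m e (2 * pi * real j / real N) Y) * v Y)"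
      using orth that by simp
    also have "\<dots> = (\<Sum>Y\<in>Conf N m. cnj (mode N j ?f Y) * v Y)"
      by (rule sum.mono_neutral_cong_right) (auto simp: psi_eq Conf_def)
    also have "\<dots> = (\<Sum>Y\<in>Conf N m. \<Sum>i=1..N. wave N j (- int i) * (of_real (?f (shift N Y (- int i))) * v Y))"
      by (simp add: mode_def sum_distrib_right wave_def exp_cnj mult.assoc)
    also have "\<dots> = (\<Sum>i=1..N. wave N j (- int i) * G (int i))"
      by (subst sum.swap) (simp add: G_def sum_distrib_left)
    finally show ?thesis by simp
  qed
  have "0 = (\<Sum>j<N. wave N j (int l) * (\<Sum>i=1..N. wave N j (- int i) * G (int i)))"
    using zero by simp
  also have "\<dots> = (\<Sum>i=1..N. (\<Sum>j<N. wave N j (int l - int i)) * G (int i))"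
    unfolding sum_distrib_left sum_distrib_right
    by (subst sum.swap) (simp add: mult.assoc[symmetric] wave_add[symmetric])
  also have "\<dots> = (\<Sum>i=1..N. if i = l then of_nat N * G (int i) else 0)"
  proof (rule sum.cong[OF refl])
    fix i assume i: "i \<in> {1..N}"
    have "(int l - int i) mod int N = 0 \<longleftrightarrow> i = l"
      using i l mod_diff_zero_iff[of l N i] by auto
    then show "(\<Sum>j<N. wave N j (int l - int i)) * G (int i) = (if i = l then of_nat N * G (int i) else 0)"
      by (simp add: wave_orthogonal N0)
  qed
  also have "\<dots> = of_nat N * G (int l)" using l by simp
  finally have "G (int l) = 0" using N0 by simp
  moreover have "G (int l) = (\<Sum>Z\<in>Conf N m. of_real (?f Z) * v (shift N Z (int l)))"
    unfolding G_def
    by (rule sum.reindex_bij_witness[of _ "\<lambda>Z. shift N Z (int l)" "\<lambda>Y. shift N Y (- int l)"])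
      (auto simp: Conf_shift N0 shift_shift shift_0 ConfD)
  ultimately show ?thesis by simp
qed

lemma other_eigenvalues:
  assumes fp: "conf_fp N m \<epsilon> es (\<lambda>Y. e (symd Y M))"
    and small: "(\<Sum>Y\<in>Conf2 N m. \<bar>e (symd Y M)\<bar>) \<le> 1/2" and eps: "4 * real m * \<bar>\<epsilon>\<bar> \<le> 1"
    and v: "in_sector N m v" "v \<noteq> (\<lambda>_. 0)" "ham N (- \<epsilon>) v = (\<lambda>Y. lam * v Y)"
    and orth: "\<forall>j<N. (\<Sum>Y\<in>Pow {0..<N}. cnj (psi N m e (2 * pi * real j / real N) Y) * v Y) = 0"
  shows "5 \<le> Re lam"
proof -
  let ?f = "\<lambda>Y. e (symd Y M)"
  define V where "V = Max ((\<lambda>Y. cmod (v Y)) ` Conf N m)"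
  have le: "cmod (v Y) \<le> V" if "Y \<in> Conf N m" for Y
    unfolding V_def using that by (intro Max_ge) auto
  have "V \<in> (\<lambda>Y. cmod (v Y)) ` Conf N m"
    unfolding V_def using M_Conf by (intro Max_in) auto
  then obtain Y where Y: "Y \<in> Conf N m" "cmod (v Y) = V" by auto
  have "V > 0"
  proof -
    obtain Z where "v Z \<noteq> 0" using v(2) by auto
    then have "Z \<in> Conf N m" using v(1) by (auto simp: in_sector_def Conf_def)
    then show ?thesis using le[of Z] \<open>v Z \<noteq> 0\<close> by (smt (verit) zero_less_norm_iff)
  qed
  have transl: "cmod (v (shift N M (int l))) \<le> V / 2" if l: "l \<in> {1..N}" for l
  proof -
    have "0 = (\<Sum>Z\<in>Conf N m. of_real (?f Z) * v (shift N Z (int l)))"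
      using orthogonal_translates[OF v(1) orth l] by simp
    also have "\<dots> = (\<Sum>Z\<in>insert M (Conf2 N m). of_real (?f Z) * v (shift N Z (int l)))"
    proof (rule sum.mono_neutral_right)
      show "insert M (Conf2 N m) \<subseteq> Conf N m" using M_Conf by (auto simp: Conf2_def)
      show "\<forall>Z\<in>Conf N m - insert M (Conf2 N m). of_real (?f Z) * v (shift N Z (int l)) = 0"
      proof
        fix Z assume Z: "Z \<in> Conf N m - insert M (Conf2 N m)"
        then have "Z \<in> (\<lambda>n. shift N M (int n)) ` {1..N}" using Conf_eq(1) by blast
        then obtain n where n: "n \<in> {1..N}" "Z = shift N M (int n)" by blast
        then have "n \<noteq> N" using Z shift_M_N by auto
        then have "?f Z = 0" using fp n by (simp add: conf_fp_def normalised_def)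
        then show "of_real (?f Z) * v (shift N Z (int l)) = 0" by simp
      qed
    qed simp
    also have "\<dots> = v (shift N M (int l)) + (\<Sum>Z\<in>Conf2 N m. of_real (?f Z) * v (shift N Z (int l)))"
      using M_notin_Conf2 fp by (simp add: conf_fp_def normalised_def)
    finally have "v (shift N M (int l)) = - (\<Sum>Z\<in>Conf2 N m. of_real (?f Z) * v (shift N Z (int l)))"
      by (simp add: eq_neg_iff_add_eq_0)
    then have "cmod (v (shift N M (int l))) \<le> (\<Sum>Z\<in>Conf2 N m. \<bar>?f Z\<bar> * V)"
      using sum_norm_le[of "Conf2 N m" "\<lambda>Z. of_real (?f Z) * v (shift N Z (int l))" "\<lambda>Z. \<bar>?f Z\<bar> * V"]
      by (simp add: norm_mult le Conf2_def Conf_shift N0 mult_left_mono)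
    also have "\<dots> \<le> 1/2 * V"
      unfolding sum_distrib_right[symmetric] using small \<open>V > 0\<close> by (intro mult_right_mono) auto
    finally show ?thesis by simp
  qed
  have Y2: "2 < card (bdry N Y)"
  proof (rule ccontr)
    assume "\<not> ?thesis"
    then have "Y \<notin> Conf2 N m" by (simp add: Conf2_def)
    then have "Y \<in> (\<lambda>n. shift N M (int n)) ` {1..N}" using Y(1) Conf_eq(1) by blast
    then obtain n where "n \<in> {1..N}" "Y = shift N M (int n)" by blast
    then show False using transl[of n] Y(2) \<open>V > 0\<close> by simp
  qed
  define n where "n = real (card (bdry N Y))"
  have "lam * v Y = 2 * of_real n * v Y + 2 * of_real \<epsilon> * (\<Sum>j\<in>bdry N Y. v (symd Y (bond N j)))"
    using fun_cong[OF v(3), of Y] ConfD(1)[OF Y(1)] by (simp add: ham_def n_def)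
  then have eq: "(2 * of_real n - lam) * v Y = - (2 * of_real \<epsilon> * (\<Sum>j\<in>bdry N Y. v (symd Y (bond N j))))"
    by (simp add: algebra_simps)
  have "cmod (2 * of_real n - lam) * V = cmod ((2 * of_real n - lam) * v Y)"
    by (simp only: norm_mult Y(2))
  also have "\<dots> = 2 * \<bar>\<epsilon>\<bar> * cmod (\<Sum>j\<in>bdry N Y. v (symd Y (bond N j)))"
    unfolding eq norm_minus_cancel by (simp add: norm_mult)
  \<comment> \<open>At most \<open>2 * m\<close> hops leave \<open>Y\<close>, and each lands in the
    sector, where amplitudes are bounded by \<open>V\<close>.\<close>
  also have "\<dots> \<le> 2 * \<bar>\<epsilon>\<bar> * (2 * real m * V)"
  proof (rule mult_left_mono)
    have "cmod (\<Sum>j\<in>bdry N Y. v (symd Y (bond N j))) \<le> (\<Sum>j\<in>bdry N Y. V)"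
      by (intro sum_norm_le le Conf_symd_bond[OF N1 Y(1)])
    also have "\<dots> \<le> 2 * real m * V"
      using card_bdry_le[OF Y(1)] \<open>V > 0\<close> by simp
    finally show "cmod (\<Sum>j\<in>bdry N Y. v (symd Y (bond N j))) \<le> 2 * real m * V" .
  qed simp
  also have "\<dots> = (4 * real m * \<bar>\<epsilon>\<bar>) * V" by simp
  also have "\<dots> \<le> 1 * V" using eps \<open>V > 0\<close> by (intro mult_right_mono) auto
  finally have "cmod (2 * of_real n - lam) \<le> 1" using \<open>V > 0\<close> by simp
  \<comment> \<open>With \<open>n \<ge> 3\<close> this yields 5, exactly the upper bound of the band
    in \<open>Re_EN_le\<close>.\<close>
  then have "2 * n - Re lam \<le> 1"
    using complex_Re_le_cmod[of "2 * of_real n - lam"] by simp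
  moreover have "3 \<le> n" using Y2 by (simp add: n_def)
  ultimately show ?thesis by linarith
qed

lemma Re_EN_le:
  assumes "(\<Sum>s=1..N. \<bar>E s\<bar>) \<le> 1"
  shows "Re (EN N E \<kappa>) \<le> 5"
proof -
  have "cmod (\<Sum>s=1..N. of_real (E s) * exp (\<i> * of_real \<kappa> * of_int (rep N s))) \<le> (\<Sum>s=1..N. \<bar>E s\<bar>)"
  proof (rule sum_norm_le)
    fix s
    have "cmod (exp (\<i> * complex_of_real (\<kappa> * of_int (rep N s)))) = 1" by (rule norm_exp_i_times)
    then show "cmod (of_real (E s) * exp (\<i> * of_real \<kappa> * of_int (rep N s))) \<le> \<bar>E s\<bar>"
      by (simp add: norm_mult mult.assoc)
  qed
  then show ?thesis
    using assms complex_Re_le_cmod[of "\<Sum>s=1..N. of_real (E s) * exp (\<i> * of_real \<kappa> * of_int (rep N s))"]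
    by (simp add: EN_def)
qed

end

section \<open>Infinite volume\<close>

text \<open>Dominated convergence for counting measure. A finite set carries the dominating sum up
  to \<open>r / 4\<close>; on it the convergence is termwise, and the two tails cost
  \<open>r / 4\<close> each.\<close>

lemma Tannery_infsum:
  fixes f :: "nat \<Rightarrow> 'i \<Rightarrow> 'b :: banach" and g :: "'i \<Rightarrow> real"
  assumes g: "g summable_on UNIV" and le: "\<And>n i. norm (f n i) \<le> g i"
    and lim: "\<And>i. (\<lambda>n. f n i) \<longlonglongrightarrow> h i"
  shows "(\<lambda>n. infsum (f n) UNIV) \<longlonglongrightarrow> infsum h UNIV"
proof (rule LIMSEQ_I)
  fix r :: real assume r: "r > 0"
  have h_le: "norm (h i) \<le> g i" for i
    by (rule LIMSEQ_le_const2[OF tendsto_norm[OF lim]]) (use le in auto)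
  have fs: "f n summable_on A" "(\<lambda>i. norm (f n i)) summable_on A" for n A
    using Infinite_Sum.abs_summable_on_comparison_test'[OF summable_on_subset[OF g subset_UNIV, of A], of "f n"] le
    by (auto intro: abs_summable_summable)
  have hs: "h summable_on A" "(\<lambda>i. norm (h i)) summable_on A" for A
    using Infinite_Sum.abs_summable_on_comparison_test'[OF summable_on_subset[OF g subset_UNIV, of A], of h] h_le
    by (auto intro: abs_summable_summable)
  obtain F where F: "finite F" "dist (sum g F) (infsum g UNIV) \<le> r / 4"
    using infsum_finite_approximation[OF g, of "r / 4"] r by auto
  have split: "infsum u UNIV = sum u F + infsum u (- F)" if "u summable_on F" "u summable_on - F"
    for u :: "'i \<Rightarrow> 'c :: banach"
    using infsum_Un_disjoint[OF that] F(1) by simp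
  have "g summable_on - F" by (rule summable_on_subset[OF g]) simp
  then have tail: "infsum g (- F) \<le> r / 4"
    using split[of g] F by (simp add: dist_real_def)
  have norm_tail: "norm (infsum u (- F)) \<le> r / 4"
    if "(\<lambda>i. norm (u i)) summable_on (- F)" "\<And>i. norm (u i) \<le> g i" for u :: "'i \<Rightarrow> 'b"
  proof -
    have "norm (infsum u (- F)) \<le> infsum (\<lambda>i. norm (u i)) (- F)"
      using that(1) by (rule norm_infsum_bound)
    also have "\<dots> \<le> infsum g (- F)"
      using that \<open>g summable_on - F\<close> by (intro infsum_mono) auto
    finally show ?thesis using tail by linarith
  qed
  have "(\<lambda>n. sum (f n) F) \<longlonglongrightarrow> sum h F" by (intro tendsto_sum lim)
  then obtain n0 where n0: "\<And>n. n \<ge> n0 \<Longrightarrow> norm (sum (f n) F - sum h F) < r / 4"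
    using LIMSEQ_D[of _ _ "r / 4"] r by (metis zero_less_divide_iff zero_less_numeral)
  have "norm (infsum (f n) UNIV - infsum h UNIV) < r" if "n \<ge> n0" for n
  proof -
    have "infsum (f n) UNIV - infsum h UNIV
        = (sum (f n) F - sum h F) + (infsum (f n) (- F) - infsum h (- F))"
      using split[OF fs(1) fs(1)] split[OF hs(1) hs(1)] by simp
    also have "norm \<dots> \<le> norm (sum (f n) F - sum h F) + (norm (infsum (f n) (- F)) + norm (infsum h (- F)))"
      by (intro norm_triangle_le add_left_mono norm_triangle_ineq4)
    also have "\<dots> < r / 4 + (r / 4 + r / 4)"
      using n0[OF that] norm_tail[OF fs(2) le] norm_tail[OF hs(2) h_le]
      by (intro add_less_le_mono add_mono) auto
    finally show ?thesis using r by linarith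
  qed
  then show "\<exists>n0. \<forall>n\<ge>n0. norm (infsum (f n) UNIV - infsum h UNIV) < r" by blast
qed

text \<open>Exchange of limits: \<open>p\<close> will count iterations and \<open>N\<close> will be
  the ring size. The error \<open>c p\<close> is uniform in \<open>N\<close>, but is required only
  eventually, because rings with \<open>N \<le> m\<close> carry no droplet equation.\<close>

lemma convergent_uniform_approx:
  fixes a :: "nat \<Rightarrow> real"
  assumes b: "\<And>p. convergent (b p)" and c: "c \<longlonglongrightarrow> 0"
    and le: "\<And>p. eventually (\<lambda>N. \<bar>a N - b p N\<bar> \<le> c p) sequentially"
  shows "convergent a"
proof (rule Cauchy_convergent, rule metric_CauchyI)
  fix r :: real assume r: "r > 0"
  then obtain p where p: "\<bar>c p\<bar> < r / 3"
    using LIMSEQ_D[OF c, of "r / 3"] by fastforce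
  have "Cauchy (b p)" using b convergent_Cauchy by blast
  then obtain N1 where N1: "\<And>M N. M \<ge> N1 \<Longrightarrow> N \<ge> N1 \<Longrightarrow> dist (b p M) (b p N) < r / 3"
    using metric_CauchyD[of "b p" "r / 3"] r by auto
  obtain N2 where N2: "\<And>N. N \<ge> N2 \<Longrightarrow> \<bar>a N - b p N\<bar> \<le> c p"
    using le[of p] by (auto simp: eventually_sequentially)
  have "dist (a M) (a N) < r" if "M \<ge> max N1 N2" "N \<ge> max N1 N2" for M N
    using N1[of M N] N2[of M] N2[of N] p that unfolding dist_real_def by linarith
  then show "\<exists>M. \<forall>m\<ge>M. \<forall>n\<ge>M. dist (a m) (a n) < r" by blast
qed

lemma summable_on_power_abs_int:
  fixes k :: real
  assumes "0 \<le> k" "k < 1"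
  shows "(\<lambda>x::int. k ^ nat \<bar>x\<bar>) summable_on UNIV"
proof -
  have nat: "(\<lambda>n::nat. k ^ n) summable_on UNIV"
    using assms by (intro norm_summable_imp_summable_on) (auto intro: summable_geometric)
  have "(\<lambda>x::int. k ^ nat \<bar>x\<bar>) summable_on range int"
    by (subst summable_on_reindex) (auto simp: o_def nat)
  moreover have "(\<lambda>x::int. k ^ nat \<bar>x\<bar>) summable_on range (\<lambda>n. - int n)"
    by (subst summable_on_reindex) (auto simp: o_def nat inj_on_def)
  ultimately have "(\<lambda>x::int. k ^ nat \<bar>x\<bar>) summable_on (range int \<union> range (\<lambda>n. - int n))"
    by (rule summable_on_union)
  moreover have "x \<in> range int \<union> range (\<lambda>n. - int n)" for x
    by (cases "x \<ge> 0") (auto intro: rev_image_eqI[of "nat \<bar>x\<bar>"])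
  then have "range int \<union> range (\<lambda>n. - int n) = UNIV" by blast
  ultimately show ?thesis by simp
qed

section \<open>Sums over residues modulo N as sums over the integers\<close>

definition window :: "nat \<Rightarrow> int set" where
  "window N = {x. - int N < 2 * x \<and> 2 * x \<le> int N}"

text \<open>Inverse of \<open>rep\<close> on the window. The class of 0 is represented by
  \<open>N\<close>, because the unknowns are numbered from 1 to \<open>N\<close>.\<close>

definition idx :: "nat \<Rightarrow> int \<Rightarrow> nat" where
  "idx N x = (if x mod int N = 0 then N else nat (x mod int N))"

lemma idx_range: "N > 0 \<Longrightarrow> idx N x \<in> {1..N}"
proof (cases "x mod int N = 0")
  case False
  assume "N > 0"
  then have "0 \<le> x mod int N" "x mod int N < int N" by simp_all
  then have "1 \<le> nat (x mod int N)" "nat (x mod int N) \<le> N" using False by linarith+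
  then show ?thesis using False by (simp add: idx_def)
qed (simp add: idx_def)

lemma idx_mod: "N > 0 \<Longrightarrow> int (idx N x) mod int N = x mod int N"
  by (simp add: idx_def)

lemma rep_window: "s \<in> {1..N} \<Longrightarrow> rep N s \<in> window N"
  by (auto simp: rep_def window_def)

lemma idx_rep: "s \<in> {1..N} \<Longrightarrow> idx N (rep N s) = s"
proof -
  assume s: "s \<in> {1..N}"
  then have "(int (idx N (rep N s)) - int s) mod int N = 0"
    using idx_mod[of N "rep N s"] rep_mod[of s N] by (simp add: mod_eq_dvd_iff)
  then show ?thesis using mod_diff_zero_iff[OF idx_range s] s by simp
qed

lemma rep_idx: "x \<in> window N \<Longrightarrow> rep N (idx N x) = x"
proof -
  assume x: "x \<in> window N"
  then have N: "N > 0" by (cases N) (auto simp: window_def)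
  have "rep N (idx N x) mod int N = x mod int N"
    using idx_mod[OF N, of x] rep_mod[of "idx N x" N] idx_range[OF N, of x] by simp
  then have "int N dvd rep N (idx N x) - x" by (simp add: mod_eq_dvd_iff)
  moreover have "\<bar>rep N (idx N x) - x\<bar> < int N"
    using x rep_window[OF idx_range[OF N, of x]] by (auto simp: window_def)
  ultimately show ?thesis using dvd_imp_le_int[of "rep N (idx N x) - x" "int N"] by (cases "rep N (idx N x) = x") auto
qed

lemma finite_window [simp]: "finite (window N)"
  by (rule finite_subset[of _ "{- int N..int N}"]) (auto simp: window_def)

text \<open>Moves the dependence on \<open>N\<close> from the index set into a cutoff of the
  summand, which is the form that dominated convergence requires.\<close>

lemma sum_window:
  fixes g :: "nat \<Rightarrow> 'b :: banach"
  assumes "N > 0"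
  shows "(\<Sum>s=1..N. g s) = infsum (\<lambda>x. if x \<in> window N then g (idx N x) else 0) UNIV"
proof -
  have "(\<Sum>s=1..N. g s) = (\<Sum>x\<in>window N. g (idx N x))"
    by (rule sum.reindex_bij_witness[of _ "idx N" "rep N"])
      (use idx_range[OF assms] in \<open>auto simp: idx_rep rep_idx rep_window simp del: atLeastAtMost_iff One_nat_def\<close>)
  also have "\<dots> = infsum (\<lambda>x. g (idx N x)) (window N)" by simp
  also have "\<dots> = infsum (\<lambda>x. if x \<in> window N then g (idx N x) else 0) UNIV"
    by (rule infsum_cong_neutral) auto
  finally show ?thesis .
qed

lemma eventually_window: "eventually (\<lambda>N. x \<in> window N) sequentially"
  unfolding eventually_sequentially
  by (rule exI[of _ "Suc (nat (2 * \<bar>x\<bar>))"]) (auto simp: window_def)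

lemma abs_le_of_window:
  assumes "x \<in> window N" "x mod int N = y mod int N"
  shows "\<bar>x\<bar> \<le> \<bar>y\<bar>"
proof -
  have "int N dvd y - x" using assms(2) by (metis mod_eq_dvd_iff)
  then obtain q where q: "y - x = int N * q" by blast
  show ?thesis
  proof (cases "q = 0")
    case False
    then have "int N * 1 \<le> int N * \<bar>q\<bar>" by (intro mult_left_mono) auto
    then have "int N \<le> \<bar>y - x\<bar>" using q by (simp add: abs_mult)
    then show ?thesis using assms(1) by (auto simp: window_def)
  qed (use q in simp)
qed

section \<open>Lower bounds for the hop distance to a translated droplet\<close>

lemma int_Suc_mod: "int (Suc j mod N) mod int N = (int j + 1) mod int N"
  by (simp add: zmod_int add.commute)

text \<open>A hop moves one down spin by one site, so every down spin can be traced back with a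
  displacement of at most 1 per hop.\<close>

lemma relpowp_stp_near:
  assumes "(stp N ^^ n) A B" "b \<in> B"
  shows "\<exists>a\<in>A. \<exists>t. \<bar>t\<bar> \<le> int n \<and> int b mod int N = (int a + t) mod int N"
  using assms
proof (induction n arbitrary: B b)
  case 0
  then show ?case by (intro bexI[of _ b] exI[of _ 0]) auto
next
  case (Suc n)
  then obtain Z where Z: "(stp N ^^ n) A Z" "stp N Z B" by auto
  then obtain j where j: "j \<in> bdry N Z" "B = symd Z (bond N j)" by (auto simp: stp_def)
  have "\<exists>c\<in>Z. \<exists>u. \<bar>u\<bar> \<le> 1 \<and> int b mod int N = (int c + u) mod int N"
  proof (cases "b \<in> Z")
    case True
    then show ?thesis by (intro bexI[of _ b] exI[of _ 0]) auto
  next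
    case False
    then have "b = j \<and> Suc j mod N \<in> Z \<or> b = Suc j mod N \<and> j \<in> Z"
      using Suc.prems j by (auto simp: symd_def bond_def bdry_def)
    then show ?thesis
    proof (elim disjE conjE)
      assume "b = j" "Suc j mod N \<in> Z"
      moreover have "int j mod int N = (int (Suc j mod N) + (- 1)) mod int N"
        using mod_diff_cong[OF int_Suc_mod[of j N] refl[of "1 mod int N"]] by simp
      ultimately show ?thesis by (intro bexI[of _ "Suc j mod N"] exI[of _ "- 1"]) auto
    next
      assume "b = Suc j mod N" "j \<in> Z"
      then show ?thesis using int_Suc_mod[of j N] by (intro bexI[of _ j] exI[of _ 1]) auto
    qed
  qed
  then obtain c u where c: "c \<in> Z" "\<bar>u\<bar> \<le> 1" "int b mod int N = (int c + u) mod int N" by blast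
  obtain a t where a: "a \<in> A" "\<bar>t\<bar> \<le> int n" "int c mod int N = (int a + t) mod int N"
    using Suc.IH[OF Z(1) c(1)] by blast
  have "int b mod int N = (int a + (t + u)) mod int N"
    using c(3) mod_add_cong[OF a(3) refl[of "u mod int N"]] by (simp add: add.assoc)
  then show ?case using a c(2) by (intro bexI[of _ a] exI[of _ "t + u"]) auto
qed

lemma relpowp_stp_sum:
  assumes "(stp N ^^ n) A B" "finite A"
  shows "finite B \<and> (\<exists>t. \<bar>t\<bar> \<le> int n \<and> (\<Sum>b\<in>B. int b) mod int N = ((\<Sum>a\<in>A. int a) + t) mod int N)"
  using assms
proof (induction n arbitrary: B)
  case 0
  then show ?case by (auto intro: exI[of _ 0])
next
  case (Suc n)
  then obtain Z where Z: "(stp N ^^ n) A Z" "stp N Z B" by auto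
  then obtain j where j: "j \<in> bdry N Z" "B = symd Z (bond N j)" by (auto simp: stp_def)
  from Suc.IH[OF Z(1) Suc.prems(2)] obtain t where fin: "finite Z" and t: "\<bar>t\<bar> \<le> int n"
    "(\<Sum>b\<in>Z. int b) mod int N = ((\<Sum>a\<in>A. int a) + t) mod int N" by blast
  let ?i = "Suc j mod N"
  have "\<exists>u. \<bar>u\<bar> \<le> 1 \<and> (\<Sum>b\<in>B. int b) mod int N = ((\<Sum>b\<in>Z. int b) + u) mod int N"
  proof (cases "j \<in> Z")
    case True
    then have "?i \<notin> Z" using j by (simp add: bdry_def)
    then have "B = insert ?i (Z - {j})" using True j by (auto simp: symd_def bond_def)
    then have "(\<Sum>b\<in>B. int b) = (\<Sum>b\<in>Z. int b) - int j + int ?i"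
      using True \<open>?i \<notin> Z\<close> fin by (simp add: sum_diff1)
    moreover have "((\<Sum>b\<in>Z. int b) - int j + int ?i) mod int N = ((\<Sum>b\<in>Z. int b) - int j + (int j + 1)) mod int N"
      by (rule mod_add_cong[OF refl int_Suc_mod])
    ultimately show ?thesis by (intro exI[of _ 1]) simp
  next
    case False
    then have "?i \<in> Z" using j by (simp add: bdry_def)
    then have "B = insert j (Z - {?i})" using False j by (auto simp: symd_def bond_def)
    then have "(\<Sum>b\<in>B. int b) = (\<Sum>b\<in>Z. int b) + int j - int ?i"
      using False \<open>?i \<in> Z\<close> fin by (simp add: sum_diff1)
    moreover have "((\<Sum>b\<in>Z. int b) + int j - int ?i) mod int N = ((\<Sum>b\<in>Z. int b) + int j - (int j + 1)) mod int N"
      by (rule mod_diff_cong[OF refl int_Suc_mod])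
    ultimately show ?thesis by (intro exI[of _ "- 1"]) simp
  qed
  then obtain u where u: "\<bar>u\<bar> \<le> 1" "(\<Sum>b\<in>B. int b) mod int N = ((\<Sum>b\<in>Z. int b) + u) mod int N" by blast
  have "(\<Sum>b\<in>B. int b) mod int N = ((\<Sum>a\<in>A. int a) + (t + u)) mod int N"
    using u(2) mod_add_cong[OF t(2) refl[of "u mod int N"]] by (simp add: add.assoc)
  moreover have "finite B" using fin j by (simp add: symd_def bond_def)
  ultimately show ?case using u(1) t(1) by (intro conjI exI[of _ "t + u"]) auto
qed

context chain
begin

lemma path_shift_M: "(stp N ^^ dst N m (shift N M x)) M (shift N M x)"
  using shift_reduce[of M x] reach_shift_M dst_path by metis

text \<open>The down spin at \<open>x\<close> is traced back to an unknown site \<open>a < m\<close>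
  of the droplet, which costs the summand \<open>m\<close>. Inside the window the way around the
  ring is no shorter.\<close>

lemma dst_ge_window:
  assumes "x \<in> window N"
  shows "nat \<bar>x\<bar> \<le> dst N m (shift N M x) + m"
proof -
  have "rot N x 0 \<in> shift N M x" using m_pos by (auto simp: shift_rot Mset_def)
  from relpowp_stp_near[OF path_shift_M this] obtain a t where
    a: "a \<in> M" "\<bar>t\<bar> \<le> int (dst N m (shift N M x))"
    "x mod int N = (int a + t) mod int N" by (auto simp: int_rot N0)
  have "\<bar>x\<bar> \<le> \<bar>int a + t\<bar>" using abs_le_of_window[OF assms a(3)] .
  moreover have "a < m" using a(1) by (simp add: Mset_def)
  ultimately show ?thesis using a(2) by linarith
qed

text \<open>A move changes the sum of the positions by one modulo \<open>N\<close>, and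
  translation by \<open>x\<close> changes it by \<open>m x\<close>.\<close>

lemma dst_ge_m:
  assumes "x \<noteq> 0" "int m * \<bar>x\<bar> + int m \<le> int N"
  shows "m \<le> dst N m (shift N M x)"
proof -
  have "(\<Sum>b\<in>shift N M x. int b) = (\<Sum>i\<in>M. (int i + x) mod int N)"
    unfolding shift_rot using inj_on_subset[OF rot_inj M_subset] by (subst sum.reindex) (auto simp: int_rot N0)
  then have "(\<Sum>b\<in>shift N M x. int b) mod int N = (\<Sum>i\<in>M. int i + x) mod int N"
    by (simp add: mod_sum_eq)
  also have "(\<Sum>i\<in>M. int i + x) = (\<Sum>i\<in>M. int i) + int m * x"
    by (simp add: sum.distrib Mset_def)
  finally have s: "(\<Sum>b\<in>shift N M x. int b) mod int N = ((\<Sum>i\<in>M. int i) + int m * x) mod int N" .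
  have "finite M" by (simp add: Mset_def)
  then obtain t where t: "\<bar>t\<bar> \<le> int (dst N m (shift N M x))"
    "(\<Sum>b\<in>shift N M x. int b) mod int N = ((\<Sum>a\<in>M. int a) + t) mod int N"
    using relpowp_stp_sum[OF path_shift_M] by blast
  have "int N dvd ((\<Sum>i\<in>M. int i) + int m * x) - ((\<Sum>a\<in>M. int a) + t)"
    using s t(2) by (metis mod_eq_dvd_iff)
  then have dvd: "int N dvd int m * x - t" by simp
  have ge: "int m \<le> \<bar>int m * x\<bar>" using assms(1) mult_left_mono[of 1 "\<bar>x\<bar>" "int m"] by (simp add: abs_mult)
  show ?thesis
  proof (rule ccontr)
    assume "\<not> ?thesis"
    then have lt: "\<bar>t\<bar> < int m" using t(1) by linarith
    then have "int m * x - t \<noteq> 0" using ge by auto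
    then have "int N \<le> \<bar>int m * x - t\<bar>" using dvd_imp_le_int[OF _ dvd] by simp
    then show False using lt assms(2) abs_triangle_ineq4[of "int m * x" t] by (simp add: abs_mult)
  qed
qed

end

section \<open>Wrapping finite configurations of the integers around the ring\<close>

definition wrap :: "nat \<Rightarrow> int \<Rightarrow> nat" where
  "wrap N z = nat (z mod int N)"

definition bdry_int :: "int set \<Rightarrow> int set" where
  "bdry_int Z = {j. (j \<in> Z) \<noteq> (j + 1 \<in> Z)}"

definition flip_int :: "int set \<Rightarrow> int \<Rightarrow> int set" where
  "flip_int Z j = (Z - {j, j + 1}) \<union> ({j, j + 1} - Z)"

lemma wrap_less: "N > 0 \<Longrightarrow> wrap N z < N"
  by (simp add: wrap_def nat_less_iff)

lemma int_wrap: "N > 0 \<Longrightarrow> int (wrap N z) = z mod int N"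
  by (simp add: wrap_def)

lemma wrap_eq_iff: "N > 0 \<Longrightarrow> wrap N x = wrap N y \<longleftrightarrow> x mod int N = y mod int N"
  by (simp add: wrap_def eq_nat_nat_iff)

lemma wrap_Suc: "N > 0 \<Longrightarrow> wrap N (z + 1) = Suc (wrap N z) mod N"
proof -
  assume N: "N > 0"
  have "int (wrap N (z + 1)) = int (Suc (wrap N z) mod N)"
    using N by (simp add: int_wrap zmod_int mod_simps add.commute)
  then show ?thesis by linarith
qed

lemma shift_wrap: "N > 0 \<Longrightarrow> shift N (wrap N ` Z) x = wrap N ` ((+) x ` Z)"
  by (simp add: shift_def image_image int_wrap wrap_def mod_simps add.commute)

lemma Mset_wrap: "m \<le> N \<Longrightarrow> Mset m = wrap N ` {0..<int m}"
proof -
  assume "m \<le> N"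
  then have "wrap N ` {0..<int m} = nat ` {0..<int m}"
    by (intro image_cong) (auto simp: wrap_def)
  moreover have "nat ` {0..<int m} = {0..<m}"
    by (auto simp: image_iff nat_less_iff intro!: bexI[of _ "int _"])
  ultimately show ?thesis by (simp add: Mset_def)
qed

lemma wrap_inj_on:
  assumes "b - a < int N"
  shows "inj_on (wrap N) {a..b}"
proof (rule inj_onI)
  fix x y assume xy: "x \<in> {a..b}" "y \<in> {a..b}" "wrap N x = wrap N y"
  then have "N > 0" using assms by auto
  then have "int N dvd x - y" using xy(3) by (simp add: wrap_eq_iff mod_eq_dvd_iff)
  moreover have "\<bar>x - y\<bar> < int N" using xy(1,2) assms by auto
  ultimately show "x = y" using dvd_imp_le_int[of "x - y" "int N"] by fastforce
qed

lemma bdry_int_subset: "Z \<subseteq> {a..b} \<Longrightarrow> bdry_int Z \<subseteq> {a - 1..b}"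
  unfolding bdry_int_def by force

text \<open>The margin 2 leaves one free site on either side of \<open>{a..b}\<close>: wrapping is
  injective on \<open>{a - 1..b + 1}\<close>, so no boundary bond is created or lost by closing up
  the ring.\<close>

lemma bdry_wrap:
  assumes Z: "Z \<subseteq> {a..b}" and N: "b - a + 2 < int N" "N > 0"
  shows "bdry N (wrap N ` Z) = wrap N ` bdry_int Z"
proof -
  have inj: "inj_on (wrap N) {a - 1..b + 1}" using N by (intro wrap_inj_on) simp
  have mem: "wrap N z \<in> wrap N ` Z \<longleftrightarrow> z \<in> Z" if "z \<in> {a - 1..b + 1}" for z
    by (rule inj_on_image_mem_iff[OF inj that]) (use Z in auto)
  show ?thesis
  proof (intro set_eqI iffI)
    fix i assume i: "i \<in> bdry N (wrap N ` Z)"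
    then have "i < N" by (simp add: bdry_def)
    show "i \<in> wrap N ` bdry_int Z"
    proof (cases "i \<in> wrap N ` Z")
      case True
      then obtain z where z: "z \<in> Z" "i = wrap N z" by blast
      then have "wrap N (z + 1) \<notin> wrap N ` Z" using i True by (simp add: bdry_def wrap_Suc N)
      then have "z \<in> bdry_int Z" using z by (auto simp: bdry_int_def)
      then show ?thesis using z by blast
    next
      case False
      then have "Suc i mod N \<in> wrap N ` Z" using i by (simp add: bdry_def)
      then obtain z where z: "z \<in> Z" "Suc i mod N = wrap N z" by blast
      have "(int i + 1) mod int N = z mod int N"
        using arg_cong[OF z(2), of int] by (simp add: int_wrap N zmod_int add.commute)
      then have "int i mod int N = (z - 1) mod int N"
        using mod_diff_cong[of "int i + 1" "int N" z 1 1] by simp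
      then have i_eq: "i = wrap N (z - 1)" using \<open>i < N\<close> by (simp add: wrap_def nat_mod_distrib)
      then have "z - 1 \<in> bdry_int Z" using z False by (auto simp: bdry_int_def)
      then show ?thesis using i_eq by blast
    qed
  next
    fix i assume "i \<in> wrap N ` bdry_int Z"
    then obtain j where j: "j \<in> bdry_int Z" "i = wrap N j" by blast
    then have "j \<in> {a - 1..b}" using bdry_int_subset[OF Z] by blast
    then show "i \<in> bdry N (wrap N ` Z)"
      using j mem[of j] mem[of "j + 1"] by (auto simp: bdry_def bdry_int_def wrap_less N simp flip: wrap_Suc)
  qed
qed

lemma symd_wrap_bond:
  assumes Z: "Z \<subseteq> {a..b}" and N: "b - a + 2 < int N" "N > 0" and j: "j \<in> bdry_int Z"
  shows "symd (wrap N ` Z) (bond N (wrap N j)) = wrap N ` flip_int Z j"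
proof -
  have inj: "inj_on (wrap N) {a - 1..b + 1}" using N by (intro wrap_inj_on) simp
  have b: "bond N (wrap N j) = wrap N ` {j, j + 1}" by (simp add: bond_def wrap_Suc N)
  have j': "{j, j + 1} \<subseteq> {a - 1..b + 1}" using bdry_int_subset[OF Z] j by auto
  have Z': "Z \<subseteq> {a - 1..b + 1}" using Z by auto
  have "wrap N ` (Z - {j, j + 1}) = wrap N ` Z - bond N (wrap N j)"
    unfolding b by (rule inj_on_image_set_diff[OF inj _ j']) (use Z' in blast)
  moreover have "wrap N ` ({j, j + 1} - Z) = bond N (wrap N j) - wrap N ` Z"
    unfolding b by (rule inj_on_image_set_diff[OF inj _ Z']) (use j' in blast)
  ultimately show ?thesis by (simp only: symd_def flip_int_def image_Un)
qed

lemma finite_int_bounds: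
  assumes "finite (Z :: int set)" obtains a b where "Z \<subseteq> {a..b}"
proof (cases "Z = {}")
  case False
  have "Z \<subseteq> {Min Z..Max Z}" using assms by auto
  then show ?thesis by (rule that)
qed (use that in auto)

lemma finite_bdry_int: "finite Z \<Longrightarrow> finite (bdry_int Z)"
  by (meson finite_int_bounds bdry_int_subset finite_atLeastAtMost_int finite_subset)

lemma finite_flip_int: "finite Z \<Longrightarrow> finite (flip_int Z j)"
  by (simp add: flip_int_def)

lemma eventually_nat_gt: "eventually (\<lambda>N. c < int N) sequentially"
  unfolding eventually_sequentially by (rule exI[of _ "Suc (nat c)"]) auto

lemma eventually_wrap_inj:
  assumes "finite Z" shows "eventually (\<lambda>N. inj_on (wrap N) Z) sequentially"
proof -
  obtain a b where ab: "Z \<subseteq> {a..b}" using assms finite_int_bounds by blast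
  show ?thesis using eventually_nat_gt[of "b - a"]
    by eventually_elim (use ab wrap_inj_on inj_on_subset in blast)
qed

lemma eventually_wrap_eq_iff:
  assumes "finite Z" "finite Z'"
  shows "eventually (\<lambda>N. wrap N ` Z = wrap N ` Z' \<longleftrightarrow> Z = Z') sequentially"
  using eventually_wrap_inj[of "Z \<union> Z'"] assms
  by (simp, elim eventually_mono) (simp add: inj_on_image_eq_iff)

lemma eventually_bdry_wrap:
  assumes "finite Z"
  shows "eventually (\<lambda>N. bdry N (wrap N ` Z) = wrap N ` bdry_int Z \<and> inj_on (wrap N) (bdry_int Z)
     \<and> (\<forall>j\<in>bdry_int Z. symd (wrap N ` Z) (bond N (wrap N j)) = wrap N ` flip_int Z j)) sequentially"
proof -
  obtain a b where ab: "Z \<subseteq> {a..b}" using assms finite_int_bounds by blast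
  show ?thesis
    using eventually_nat_gt[of "b - a + 2"] eventually_gt_at_top[of 0]
      eventually_wrap_inj[OF finite_bdry_int[OF assms]]
  proof eventually_elim
    case (elim N)
    then show ?case
      using bdry_wrap[OF ab elim(1,2)] symd_wrap_bond[OF ab elim(1,2)] by simp
  qed
qed

text \<open>On large rings the hops out of a fixed finite \<open>Z\<close> are those on the
  integers, so the sum has a fixed finite index set and converges term by term.\<close>

lemma convergent_Lap_wrap:
  assumes "finite Z" and F: "\<And>Z. finite Z \<Longrightarrow> convergent (\<lambda>N. F N (wrap N ` Z))"
  shows "convergent (\<lambda>N. Lap N (F N) (wrap N ` Z))"
proof -
  have "eventually (\<lambda>N. Lap N (F N) (wrap N ` Z) = (\<Sum>j\<in>bdry_int Z. F N (wrap N ` flip_int Z j))) sequentially"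
    using eventually_bdry_wrap[OF assms(1)]
    by eventually_elim (simp add: Lap_def sum.reindex)
  moreover have "convergent (\<lambda>N. \<Sum>j\<in>bdry_int Z. F N (wrap N ` flip_int Z j))"
    by (intro convergent_sum F finite_flip_int assms(1))
  ultimately show ?thesis by (simp add: convergent_cong)
qed

section \<open>Convergence of the iterates as the ring grows, with k the same for all N\<close>

locale small_coupling =
  fixes m :: nat and k \<epsilon> :: real
  assumes m_pos: "0 < m" and k_pos: "0 < k" and k_less: "k < 1" and eps_small: "12 * \<bar>\<epsilon>\<bar> \<le> k"
begin

lemma chain: "m < N \<Longrightarrow> contraction_chain N m k \<epsilon>"
  using m_pos k_pos k_less eps_small by unfold_locales auto

lemma eventually_gt_m: "eventually (\<lambda>N. m < N) sequentially"
  by (rule eventually_gt_at_top)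

text \<open>The dominating sequence obtained from \<open>dst_ge_window\<close>; the division by
  \<open>k ^ m\<close> compensates for the loss of \<open>m\<close> in that bound.\<close>

definition decay :: "int \<Rightarrow> real" where
  "decay x = k ^ nat \<bar>x\<bar> / k ^ m"

lemma decay_nonneg: "0 \<le> decay x"
  using k_pos by (simp add: decay_def)

lemma summable_decay: "decay summable_on UNIV"
proof -
  have "(\<lambda>x. k ^ nat \<bar>x\<bar> * inverse (k ^ m)) summable_on UNIV"
    using k_pos k_less by (intro summable_on_cmult_left summable_on_power_abs_int) auto
  then show ?thesis by (simp add: decay_def[abs_def] field_simps)
qed

lemma decay_bound:
  assumes N: "m < N" and E: "\<And>n. n \<in> {1..N} \<Longrightarrow> \<bar>E n\<bar> \<le> k ^ dst N m (shift N (Mset m) (int n))"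
    and x: "x \<in> window N"
  shows "\<bar>E (idx N x)\<bar> \<le> decay x"
proof -
  interpret contraction_chain N m k \<epsilon> using chain[OF N] .
  have sh: "shift N M (int (idx N x)) = shift N M x"
    by (rule shift_cong) (simp add: idx_mod N0)
  have "k ^ (dst N m (shift N M x) + m) \<le> k ^ nat \<bar>x\<bar>"
    using k_pos k_le dst_ge_window[OF x] by (intro power_decreasing) auto
  then have "k ^ dst N m (shift N M x) \<le> decay x"
    using k_pos by (simp add: decay_def power_add field_simps)
  then show ?thesis using E[OF idx_range[OF N0, of x]] unfolding sh by linarith
qed

lemma convergent_Conv:
  assumes Z: "finite Z"
    and F: "\<And>Z. finite Z \<Longrightarrow> convergent (\<lambda>N. F N (wrap N ` Z))" and F1: "\<And>N Y. m < N \<Longrightarrow> \<bar>F N Y\<bar> \<le> 1"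
    and E: "\<And>x. convergent (\<lambda>N. E N (idx N x))"
    and E1: "\<And>N x. m < N \<Longrightarrow> x \<in> window N \<Longrightarrow> \<bar>E N (idx N x)\<bar> \<le> decay x"
  shows "convergent (\<lambda>N. Conv N (E N) (F N) (wrap N ` Z))"
proof -
  \<comment> \<open>Set to 0 on rings that are too small or windows that miss \<open>x\<close>, so
    that the domination holds for every \<open>N\<close> and not only eventually.\<close>
  define u where "u N x = (if m < N \<and> x \<in> window N then E N (idx N x) * F N (wrap N ` ((+) x ` Z)) else 0)" for N x
  have "convergent (\<lambda>N. u N x)" for x
  proof -
    have "eventually (\<lambda>N. u N x = E N (idx N x) * F N (wrap N ` ((+) x ` Z))) sequentially"
      using eventually_gt_m eventually_window[of x] by eventually_elim (simp add: u_def)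
    moreover have "convergent (\<lambda>N. E N (idx N x) * F N (wrap N ` ((+) x ` Z)))"
      by (intro convergent_mult E F finite_imageI Z)
    ultimately show ?thesis by (simp add: convergent_cong)
  qed
  then have lim: "(\<lambda>N. u N x) \<longlonglongrightarrow> lim (\<lambda>N. u N x)" for x
    by (simp add: convergent_LIMSEQ_iff)
  have "norm (u N x) \<le> decay x" for N x
  proof (cases "m < N \<and> x \<in> window N")
    case True
    then have "\<bar>E N (idx N x)\<bar> * \<bar>F N (wrap N ` ((+) x ` Z))\<bar> \<le> decay x * 1"
      using E1 F1 decay_nonneg by (intro mult_mono) auto
    then show ?thesis using True by (simp add: u_def abs_mult)
  qed (auto simp: u_def decay_nonneg)
  from Tannery_infsum[OF summable_decay this lim]
  have "convergent (\<lambda>N. infsum (u N) UNIV)" by (rule convergentI)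
  moreover have "eventually (\<lambda>N. Conv N (E N) (F N) (wrap N ` Z) = infsum (u N) UNIV) sequentially"
    using eventually_gt_m
  proof eventually_elim
    case (elim N)
    then have N: "N > 0" by simp
    have "Conv N (E N) (F N) (wrap N ` Z) = infsum (\<lambda>x. if x \<in> window N
        then E N (idx N x) * F N (shift N (wrap N ` Z) (int (idx N x))) else 0) UNIV"
      unfolding Conv_def by (rule sum_window[OF N])
    also have "\<dots> = infsum (u N) UNIV"
    proof (rule infsum_cong)
      fix x
      have "shift N (wrap N ` Z) (int (idx N x)) = wrap N ` ((+) x ` Z)"
        using shift_cong[of "int (idx N x)" N x] idx_mod[OF N] shift_wrap[OF N] by metis
      then show "(if x \<in> window N then E N (idx N x) * F N (shift N (wrap N ` Z) (int (idx N x))) else 0) = u N x"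
        using elim by (simp add: u_def)
    qed
    finally show ?case .
  qed
  ultimately show ?thesis by (simp add: convergent_cong)
qed

lemma eventually_Conf2_wrap:
  assumes "finite Z"
  shows "eventually (\<lambda>N. wrap N ` Z \<in> Conf2 N m \<longleftrightarrow> card Z = m \<and> 2 < card (bdry_int Z)) sequentially"
  using eventually_bdry_wrap[OF assms] eventually_wrap_inj[OF assms] eventually_gt_m
proof eventually_elim
  case (elim N)
  then have "wrap N ` Z \<subseteq> {0..<N}" by (auto simp: wrap_less)
  then show ?case using elim by (simp add: Conf2_def Conf_def card_image)
qed

text \<open>Configurations and indices are described on the integers, so that the same coordinate
  can be followed through all rings. Both components are treated in one induction because each step
  uses the hop sums of one and convolves it with the other.\<close>

lemma iterate_convergent:
  "(\<forall>Z. finite Z \<longrightarrow> convergent (\<lambda>N. itF N m \<epsilon> p (wrap N ` Z))) \<and>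
   (\<forall>x. convergent (\<lambda>N. itE N m \<epsilon> p (idx N x)))"
proof (induction p)
  case 0
  have "convergent (\<lambda>N. itF N m \<epsilon> 0 (wrap N ` Z))" if Z: "finite Z" for Z
  proof -
    have "eventually (\<lambda>N. itF N m \<epsilon> 0 (wrap N ` Z) = (if Z = {0..<int m} then 1 else 0)) sequentially"
      using eventually_wrap_eq_iff[OF Z, of "{0..<int m}", simplified] eventually_gt_m
      by eventually_elim (simp flip: Mset_wrap)
    then show ?thesis by (simp add: convergent_cong convergent_const)
  qed
  then show ?case by (simp add: convergent_const)
next
  case (Suc p)
  then have IHF: "\<And>Z. finite Z \<Longrightarrow> convergent (\<lambda>N. itF N m \<epsilon> p (wrap N ` Z))"
    and IHE: "\<And>x. convergent (\<lambda>N. itE N m \<epsilon> p (idx N x))" by auto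
  have "convergent (\<lambda>N. itE N m \<epsilon> (Suc p) (idx N x))" for x
  proof -
    let ?Z = "(+) (- x) ` {0..<int m}"
    have "eventually (\<lambda>N. itE N m \<epsilon> (Suc p) (idx N x) = 2 * \<epsilon> * Lap N (itF N m \<epsilon> p) (wrap N ` ?Z)) sequentially"
      using eventually_gt_m
    proof eventually_elim
      case (elim N)
      then have N: "N > 0" by simp
      have "(- int (idx N x)) mod int N = (- x) mod int N"
        by (rule mod_minus_cong) (rule idx_mod[OF N])
      then have "shift N (Mset m) (- int (idx N x)) = shift N (wrap N ` {0..<int m}) (- x)"
        using shift_cong Mset_wrap[of m N] elim by (metis less_imp_le)
      then show ?case by (simp add: stepE_def shift_wrap[OF N])
    qed
    moreover have "convergent (\<lambda>N. 2 * \<epsilon> * Lap N (itF N m \<epsilon> p) (wrap N ` ?Z))"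
      by (intro convergent_mult convergent_const convergent_Lap_wrap IHF) auto
    ultimately show ?thesis by (simp add: convergent_cong)
  qed
  moreover have "convergent (\<lambda>N. itF N m \<epsilon> (Suc p) (wrap N ` Z))" if Z: "finite Z" for Z
  proof -
    let ?d = "real (card (bdry_int Z)) - 2"
    \<comment> \<open>On large rings the tests in \<open>stepF\<close> are decided by
      \<open>Z\<close> alone, so one branch applies for all such \<open>N\<close>.\<close>
    let ?r = "\<lambda>N. if Z = {0..<int m} then 1
       else if card Z = m \<and> 2 < card (bdry_int Z) then
         - \<epsilon> / ?d * Lap N (itF N m \<epsilon> p) (wrap N ` Z)
         + 1/2 * (1 / ?d) * Conv N (itE N m \<epsilon> p) (itF N m \<epsilon> p) (wrap N ` Z)
       else 0"
    have eq: "eventually (\<lambda>N. itF N m \<epsilon> (Suc p) (wrap N ` Z) = ?r N) sequentially"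
      using eventually_wrap_eq_iff[OF Z, of "{0..<int m}", simplified] eventually_gt_m
        eventually_Conf2_wrap[OF Z] eventually_bdry_wrap[OF Z]
      by eventually_elim (simp add: stepF_def card_image flip: Mset_wrap)
    have "convergent (\<lambda>N. Lap N (itF N m \<epsilon> p) (wrap N ` Z))"
      by (rule convergent_Lap_wrap[where F = "\<lambda>N. itF N m \<epsilon> p"]) (use Z IHF in auto)
    moreover have "convergent (\<lambda>N. Conv N (itE N m \<epsilon> p) (itF N m \<epsilon> p) (wrap N ` Z))"
    proof (rule convergent_Conv[where F = "\<lambda>N. itF N m \<epsilon> p" and E = "\<lambda>N. itE N m \<epsilon> p"])
      fix N assume N: "m < N"
      interpret contraction_chain N m k \<epsilon> using chain[OF N] .
      show "\<bar>itF N m \<epsilon> p Y\<bar> \<le> 1" for Y by (rule itF_le1)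
      show "\<bar>itE N m \<epsilon> p (idx N x)\<bar> \<le> decay x" if "x \<in> window N" for x
        using decay_bound[OF N itE_le that] .
    qed (use Z IHF IHE in auto)
    ultimately have c: "convergent (\<lambda>N. - \<epsilon> / ?d * Lap N (itF N m \<epsilon> p) (wrap N ` Z)
         + 1/2 * (1 / ?d) * Conv N (itE N m \<epsilon> p) (itF N m \<epsilon> p) (wrap N ` Z))"
      by (intro convergent_add convergent_mult convergent_const)
    have "convergent ?r"
      by (cases "Z = {0..<int m}"; cases "card Z = m \<and> 2 < card (bdry_int Z)";
        simp only: simp_thms if_True if_False convergent_const c)
    then show ?thesis using eq by (simp only: convergent_cong)
  qed
  ultimately show ?case by blast
qed

end

section \<open>The theorem\<close>

context contraction_chain
begin

lemma itE_close:
  assumes "conf_fp N m \<epsilon> E f" "norm1 E f \<le> 1" "n \<in> {1..N}"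
  shows "\<bar>itE N m \<epsilon> p n - E n\<bar> \<le> 2 * (3/4) ^ p"
  using NE_coord1[OF assms(3), of "\<lambda>n. itE N m \<epsilon> p n - E n"] iterate_close[OF assms(1,2), of p]
    NF_nonneg[of "\<lambda>Y. itF N m \<epsilon> p Y - f Y"] by linarith

text \<open>Both solutions are limits of the same iterates, whose error bound holds for every fixed
  point in the unit ball. Only the \<open>E\<close> part is compared, since it alone determines the
  energies.\<close>

lemma fp_unique:
  assumes "conf_fp N m \<epsilon> E f" "norm1 E f \<le> 1" "conf_fp N m \<epsilon> E' f'" "norm1 E' f' \<le> 1" "n \<in> {1..N}"
  shows "E n = E' n"
proof -
  have "(\<lambda>p. itE N m \<epsilon> p n) \<longlonglongrightarrow> X n" if "\<And>p. \<bar>itE N m \<epsilon> p n - X n\<bar> \<le> 2 * (3/4) ^ p" for X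
  proof (rule LIM_zero_cancel, rule Lim_null_comparison)
    show "(\<lambda>p. 2 * (3/4) ^ p :: real) \<longlonglongrightarrow> 0"
      by (intro tendsto_mult_right_zero LIMSEQ_realpow_zero) auto
  qed (use that in auto)
  from this[of E, OF itE_close[OF assms(1,2,5)]] this[of E', OF itE_close[OF assms(3,4,5)]]
  show ?thesis by (rule LIMSEQ_unique)
qed

end

context small_coupling
begin

text \<open>The coefficients are read off from one chosen family of fixed points; uniqueness
  transfers the limit to every other family, which is why \<open>d\<close> can be fixed before
  \<open>E\<close> and \<open>f\<close> are quantified. Summability comes from \<open>decay\<close>,
  the bound \<open>k ^ m\<close> from \<open>dst_ge_m\<close> on large rings.\<close>

lemma thermodynamic_limit:
  "\<exists>d :: int \<Rightarrow> complex. (\<lambda>x. norm (d x)) summable_on UNIV \<and> (\<forall>x. x \<noteq> 0 \<longrightarrow> norm (d x) \<le> k ^ m) \<and>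
     (\<forall>E f. (\<forall>N>m. conf_fp N m \<epsilon> (E N) (f N) \<and> NE N m k (E N) + NF N m k (f N) \<le> 1) \<longrightarrow>
       (\<forall>\<kappa>. (\<lambda>N. EN N (E N) \<kappa>) \<longlonglongrightarrow> 4 + infsum (\<lambda>x. d x * exp (\<i> * of_real \<kappa> * of_int x)) UNIV))"
proof -
  have "\<forall>N. \<exists>E. m < N \<longrightarrow> (\<exists>f. conf_fp N m \<epsilon> E f \<and> NE N m k E + NF N m k f \<le> 1)"
    using contraction_chain.fp_exists[OF chain] by blast
  then obtain E where "\<And>N. m < N \<Longrightarrow> \<exists>f. conf_fp N m \<epsilon> (E N) f \<and> NE N m k (E N) + NF N m k f \<le> 1"
    by metis
  then obtain f where fp: "\<And>N. m < N \<Longrightarrow> conf_fp N m \<epsilon> (E N) (f N)"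
    and le: "\<And>N. m < N \<Longrightarrow> NE N m k (E N) + NF N m k (f N) \<le> 1" by metis
  have E_le: "\<bar>E N n\<bar> \<le> k ^ dst N m (shift N (Mset m) (int n))" if "m < N" "n \<in> {1..N}" for N n
  proof -
    interpret contraction_chain N m k \<epsilon> using chain[OF that(1)] .
    show ?thesis using le[OF that(1)] NF_nonneg[of "f N"] that(2) by (intro NE_le1_coord) auto
  qed
  have E_decay: "\<bar>E N (idx N x)\<bar> \<le> decay x" if "m < N" "x \<in> window N" for N x
    using decay_bound[OF that(1) E_le[OF that(1)] that(2)] .
  have "convergent (\<lambda>N. E N (idx N x))" for x
  proof (rule convergent_uniform_approx)
    show "convergent (\<lambda>N. itE N m \<epsilon> p (idx N x))" for p using iterate_convergent by blast
    show "(\<lambda>p. 2 * (3/4) ^ p :: real) \<longlonglongrightarrow> 0"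
      by (intro tendsto_mult_right_zero LIMSEQ_realpow_zero) auto
    show "eventually (\<lambda>N. \<bar>E N (idx N x) - itE N m \<epsilon> p (idx N x)\<bar> \<le> 2 * (3/4) ^ p) sequentially" for p
      using eventually_gt_m
    proof eventually_elim
      case (elim N)
      interpret contraction_chain N m k \<epsilon> using chain[OF elim] .
      show ?case using itE_close[OF fp[OF elim] le[OF elim] idx_range[OF N0, of x], of p]
        by (simp add: abs_minus_commute)
    qed
  qed
  then obtain D where D: "\<And>x. (\<lambda>N. E N (idx N x)) \<longlonglongrightarrow> D x" unfolding convergent_def by metis
  have D_decay: "\<bar>D x\<bar> \<le> decay x" for x
  proof (rule LIMSEQ_le_const2[OF tendsto_rabs[OF D]])
    have "eventually (\<lambda>N. \<bar>E N (idx N x)\<bar> \<le> decay x) sequentially"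
      using eventually_gt_m eventually_window[of x] by eventually_elim (rule E_decay)
    then show "\<exists>N. \<forall>n\<ge>N. \<bar>E n (idx n x)\<bar> \<le> decay x" by (simp add: eventually_sequentially)
  qed
  have "\<bar>D x\<bar> \<le> k ^ m" if "x \<noteq> 0" for x
  proof (rule LIMSEQ_le_const2[OF tendsto_rabs[OF D]])
    have "eventually (\<lambda>N. \<bar>E N (idx N x)\<bar> \<le> k ^ m) sequentially"
      using eventually_gt_m eventually_nat_gt[of "int m * \<bar>x\<bar> + int m"]
    proof eventually_elim
      case (elim N)
      interpret contraction_chain N m k \<epsilon> using chain[OF elim(1)] .
      have "shift N M (int (idx N x)) = shift N M x"
        by (rule shift_cong) (simp add: idx_mod N0)
      then have "\<bar>E N (idx N x)\<bar> \<le> k ^ dst N m (shift N M x)"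
        using E_le[OF elim(1) idx_range[OF N0, of x]] by simp
      also have "\<dots> \<le> k ^ m"
        using k_pos k_le dst_ge_m[OF that] elim(2) by (intro power_decreasing) auto
      finally show ?case .
    qed
    then show "\<exists>N. \<forall>n\<ge>N. \<bar>E n (idx n x)\<bar> \<le> k ^ m" by (simp add: eventually_sequentially)
  qed
  moreover have "(\<lambda>x. \<bar>D x\<bar>) summable_on UNIV"
    by (rule summable_on_comparison_test[OF summable_decay]) (auto simp: D_decay)
  moreover have "(\<lambda>N. EN N (E' N) \<kappa>) \<longlonglongrightarrow>
      4 + infsum (\<lambda>x. of_real (D x) * exp (\<i> * of_real \<kappa> * of_int x)) UNIV"
    if fp': "\<forall>N>m. conf_fp N m \<epsilon> (E' N) (f' N) \<and> NE N m k (E' N) + NF N m k (f' N) \<le> 1" for E' f' \<kappa>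
  proof -
    define u where "u N x = (if m < N \<and> x \<in> window N
      then complex_of_real (E N (idx N x)) * exp (\<i> * of_real \<kappa> * of_int x) else 0)" for N x
    have unit: "cmod (exp (\<i> * of_real \<kappa> * of_int x)) = 1" for x
      using norm_exp_i_times[of "\<kappa> * of_int x"] by (simp add: mult.assoc)
    have "(\<lambda>N. infsum (u N) UNIV) \<longlonglongrightarrow>
        infsum (\<lambda>x. of_real (D x) * exp (\<i> * of_real \<kappa> * of_int x)) UNIV"
    proof (rule Tannery_infsum[OF summable_decay])
      show "norm (u N x) \<le> decay x" for N x
        using E_decay[of N x] decay_nonneg by (auto simp: u_def norm_mult unit)
      show "(\<lambda>N. u N x) \<longlonglongrightarrow> of_real (D x) * exp (\<i> * of_real \<kappa> * of_int x)" for x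
      proof (rule Lim_transform_eventually)
        show "(\<lambda>N. of_real (E N (idx N x)) * exp (\<i> * of_real \<kappa> * of_int x))
            \<longlonglongrightarrow> of_real (D x) * exp (\<i> * of_real \<kappa> * of_int x)"
          by (intro tendsto_mult tendsto_of_real D tendsto_const)
        show "eventually (\<lambda>N. of_real (E N (idx N x)) * exp (\<i> * of_real \<kappa> * of_int x) = u N x) sequentially"
          using eventually_gt_m eventually_window[of x] by eventually_elim (simp add: u_def)
      qed
    qed
    then have "(\<lambda>N. 4 + infsum (u N) UNIV) \<longlonglongrightarrow>
        4 + infsum (\<lambda>x. of_real (D x) * exp (\<i> * of_real \<kappa> * of_int x)) UNIV"
      by (intro tendsto_add tendsto_const)
    then show ?thesis
    proof (rule Lim_transform_eventually)
      show "eventually (\<lambda>N. 4 + infsum (u N) UNIV = EN N (E' N) \<kappa>) sequentially"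
        using eventually_gt_m
      proof eventually_elim
        case (elim N)
        then have N: "N > 0" by simp
        have eq: "E' N n = E N n" if "n \<in> {1..N}" for n
          using contraction_chain.fp_unique[OF chain[OF elim]] fp' fp[OF elim] le[OF elim] elim that by blast
        have "(\<Sum>s=1..N. of_real (E' N s) * exp (\<i> * of_real \<kappa> * of_int (rep N s)))
          = infsum (\<lambda>x. if x \<in> window N then of_real (E' N (idx N x)) *
               exp (\<i> * of_real \<kappa> * of_int (rep N (idx N x))) else 0) UNIV"
          by (rule sum_window[OF N])
        also have "\<dots> = infsum (u N) UNIV"
          by (rule infsum_cong) (simp add: u_def elim rep_idx eq[OF idx_range[OF N]])
        finally show ?case by (simp add: EN_def)
      qed
    qed
  qed
  ultimately show ?thesis by (intro exI[of _ "\<lambda>x. of_real (D x)"]) simp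
qed

end

section \<open>The case of zero coupling\<close>

context chain
begin

text \<open>The equation itself decides, with no recourse to the norm: hop terms carry the factor
  \<open>\<epsilon>\<close>, so \<open>E\<close> vanishes, and then the quadratic term, the only
  other source of \<open>f\<close>, vanishes as well.\<close>

lemma zero_coupling:
  assumes "conf_fp N m 0 E f"
  shows "n \<in> {1..N} \<Longrightarrow> E n = 0" "Y \<in> Conf2 N m \<Longrightarrow> f Y = 0"
proof -
  show E: "E n = 0" if "n \<in> {1..N}" for n
    using assms that by (simp add: conf_fp_def stepE_def)
  show "f Y = 0" if Y: "Y \<in> Conf2 N m"
  proof -
    have "Conv N E f Y = 0" unfolding Conv_def by (intro sum.neutral) (use E in auto)
    moreover have "Y \<noteq> M" using Y M_notin_Conf2 by auto
    ultimately show ?thesis using assms Y by (simp add: conf_fp_def stepF_def)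
  qed
qed

lemma zero_coupling_exists:
  "conf_fp N m 0 (\<lambda>_. 0) (\<lambda>Y. if Y = M then 1 else 0)"
  "NE N m k (\<lambda>_. 0) + NF N m k (\<lambda>Y. if Y = M then 1 else 0) = 0"
proof -
  have ne: "Y \<noteq> M" if "Y \<in> Conf2 N m" for Y using that M_notin_Conf2 by auto
  show "conf_fp N m 0 (\<lambda>_. 0) (\<lambda>Y. if Y = M then 1 else 0)"
    using shift_M_eq_M ne by (simp add: conf_fp_def normalised_def stepE_def stepF_def Conv_def)
  show "NE N m k (\<lambda>_. 0) + NF N m k (\<lambda>Y. if Y = M then 1 else 0) = 0"
    using ne by (simp add: NE_def NF_Conf2)
qed

end

text \<open>The constant \<open>12 + 4 m\<close> serves both the contraction estimate (\<open>12\<close>) and the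
  separation of the spectrum (\<open>4 m\<close>). At \<open>\<epsilon> = 0\<close> all weights of configurations other
  than \<open>M\<close> degenerate to \<open>inverse 0 = 0\<close>, so this case is treated apart.\<close>

locale droplet =
  fixes m :: nat and \<epsilon> :: real
  assumes m_pos: "0 < m" and coupling: "(12 + 4 * real m) * \<bar>\<epsilon>\<bar> < 1"
begin

abbreviation "K \<equiv> 12 + 4 * real m"

lemma chain: "m < N \<Longrightarrow> chain N m"
  using m_pos by unfold_locales

lemma small_coupling: "\<epsilon> \<noteq> 0 \<Longrightarrow> small_coupling m (K * \<bar>\<epsilon>\<bar>) \<epsilon>"
  using m_pos coupling by unfold_locales (auto simp: distrib_right intro: add_pos_nonneg)

lemma fp_existence:
  assumes N: "m < N"
  shows "\<exists>es e. is_fp N m \<epsilon> es e \<and> fp_norm N m K \<epsilon> es e \<le> 1"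
proof -
  interpret chain N m using chain[OF N] .
  have "\<exists>E f. conf_fp N m \<epsilon> E f \<and> NE N m (K * \<bar>\<epsilon>\<bar>) E + NF N m (K * \<bar>\<epsilon>\<bar>) f \<le> 1"
  proof (cases "\<epsilon> = 0")
    case True
    then show ?thesis using zero_coupling_exists by (metis order.refl zero_le_one)
  next
    case False
    then show ?thesis
      using contraction_chain.fp_exists[OF small_coupling.chain[OF small_coupling N]] by blast
  qed
  then obtain E f where "conf_fp N m \<epsilon> E f" "NE N m (K * \<bar>\<epsilon>\<bar>) E + NF N m (K * \<bar>\<epsilon>\<bar>) f \<le> 1" by blast
  then show ?thesis
    by (intro exI[of _ E] exI[of _ "\<lambda>X. f (symd X M)"]) (simp add: is_fp_iff fp_norm_eq)
qed

lemma spectral_gap: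
  assumes N: "m < N" and fp: "is_fp N m \<epsilon> es e" and le: "fp_norm N m K \<epsilon> es e \<le> 1"
    and v: "in_sector N m v" "v \<noteq> (\<lambda>_. 0)" "ham N (- \<epsilon>) v = (\<lambda>Y. lam * v Y)"
      "\<forall>j<N. (\<Sum>Y\<in>Pow {0..<N}. cnj (psi N m e (2 * pi * real j / real N) Y) * v Y) = 0"
  shows "Re (EN N es \<kappa>) \<le> Re lam"
proof -
  interpret chain N m using chain[OF N] .
  let ?f = "\<lambda>Y. e (symd Y M)"
  have cfp: "conf_fp N m \<epsilon> es ?f" using fp by (simp add: is_fp_iff)
  have small: "(\<Sum>s=1..N. \<bar>es s\<bar>) \<le> 1 \<and> (\<Sum>Y\<in>Conf2 N m. \<bar>?f Y\<bar>) \<le> 1/2"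
  proof (cases "\<epsilon> = 0")
    case True
    then have "\<And>n. n \<in> {1..N} \<Longrightarrow> es n = 0" "\<And>Y. Y \<in> Conf2 N m \<Longrightarrow> ?f Y = 0"
      using zero_coupling cfp by blast+
    then show ?thesis by simp
  next
    case False
    then interpret contraction_chain N m "K * \<bar>\<epsilon>\<bar>" \<epsilon>
      using small_coupling.chain[OF small_coupling N] by blast
    show ?thesis
      using le sum_abs_le_NE[of es] sum_abs_le_NF[of ?f] NE_nonneg[of es] NF_nonneg[of ?f]
      unfolding fp_norm_eq by linarith
  qed
  have "4 * real m * \<bar>\<epsilon>\<bar> \<le> 1" using coupling by (simp add: distrib_right)
  then have "5 \<le> Re lam" by (rule other_eigenvalues[OF cfp conjunct2[OF small] _ v])
  moreover have "Re (EN N es \<kappa>) \<le> 5" using small by (intro Re_EN_le) simp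
  ultimately show ?thesis by linarith
qed

lemma infinite_volume_limit:
  "\<exists>d::int \<Rightarrow> complex. (\<lambda>s. norm (d s)) summable_on UNIV
     \<and> (\<forall>s. s \<noteq> 0 \<longrightarrow> norm (d s) \<le> K ^ m * \<bar>\<epsilon>\<bar> ^ m)
     \<and> (\<forall>es e. (\<forall>N. m < N \<longrightarrow> is_fp N m \<epsilon> (es N) (e N) \<and> fp_norm N m K \<epsilon> (es N) (e N) \<le> 1)
          \<longrightarrow> (\<forall>\<kappa>::real. (\<lambda>N. EN N (es N) \<kappa>) \<longlonglongrightarrow>
                 4 + infsum (\<lambda>s. d s * exp (\<i> * of_real \<kappa> * of_int s)) UNIV))"
proof (cases "\<epsilon> = 0")
  case True
  have "(\<lambda>N. EN N (es N) \<kappa>) \<longlonglongrightarrow> 4"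
    if fp: "\<forall>N. m < N \<longrightarrow> is_fp N m \<epsilon> (es N) (e N) \<and> fp_norm N m K \<epsilon> (es N) (e N) \<le> 1" for es e \<kappa>
  proof (rule tendsto_eventually)
    show "eventually (\<lambda>N. EN N (es N) \<kappa> = 4) sequentially"
      using eventually_gt_at_top[of m]
    proof eventually_elim
      case (elim N)
      interpret chain N m using chain[OF elim] .
      have "conf_fp N m 0 (es N) (\<lambda>Y. e N (symd Y M))"
        using fp elim True is_fp_iff[of 0 "es N" "e N"] by simp
      from zero_coupling(1)[OF this] show ?case by (simp add: EN_def)
    qed
  qed
  then show ?thesis by (intro exI[of _ "\<lambda>_. 0"]) auto
next
  case False
  let ?k = "K * \<bar>\<epsilon>\<bar>"
  obtain d :: "int \<Rightarrow> complex" where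
    d: "(\<lambda>s. norm (d s)) summable_on UNIV" "\<forall>s. s \<noteq> 0 \<longrightarrow> norm (d s) \<le> ?k ^ m" and
    lim: "\<forall>E f. (\<forall>N>m. conf_fp N m \<epsilon> (E N) (f N) \<and> NE N m ?k (E N) + NF N m ?k (f N) \<le> 1) \<longrightarrow>
      (\<forall>\<kappa>. (\<lambda>N. EN N (E N) \<kappa>) \<longlonglongrightarrow> 4 + infsum (\<lambda>s. d s * exp (\<i> * of_real \<kappa> * of_int s)) UNIV)"
    using small_coupling.thermodynamic_limit[OF small_coupling[OF False]]
    by (elim exE conjE) (rule that)
  have "(\<lambda>N. EN N (es N) \<kappa>) \<longlonglongrightarrow> 4 + infsum (\<lambda>s. d s * exp (\<i> * of_real \<kappa> * of_int s)) UNIV"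
    if "\<forall>N. m < N \<longrightarrow> is_fp N m \<epsilon> (es N) (e N) \<and> fp_norm N m K \<epsilon> (es N) (e N) \<le> 1" for es e \<kappa>
    by (rule lim[rule_format, of es "\<lambda>N Y. e N (symd Y (Mset m))"])
      (use that chain.is_fp_iff[OF chain] chain.fp_norm_eq[OF chain] in simp)
  then show ?thesis using d by (intro exI[of _ d]) (simp add: power_mult_distrib)
qed

end

theorem theorem1:
  shows "\<forall>m::nat. m > 0 \<longrightarrow> (\<exists>K::real. K > 0 \<and> (\<exists>B::real. B > 0 \<and> (\<exists>C::real.
    \<forall>\<epsilon>::real. K * \<bar>\<epsilon>\<bar> < 1 \<longrightarrow>
      (\<forall>N. m < N \<longrightarrow> (\<exists>es e. is_fp N m \<epsilon> es e \<and> fp_norm N m K \<epsilon> es e \<le> B))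
    \<and> (\<forall>N es e. m < N \<and> is_fp N m \<epsilon> es e \<and> fp_norm N m K \<epsilon> es e \<le> B \<longrightarrow>
          (\<forall>j<N. psi N m e (2 * pi * real j / real N) \<noteq> (\<lambda>_. 0)
               \<and> in_sector N m (psi N m e (2 * pi * real j / real N))
               \<and> transl N (psi N m e (2 * pi * real j / real N))
                   = (\<lambda>Y. exp (- \<i> * of_real (2 * pi * real j / real N)) * psi N m e (2 * pi * real j / real N) Y)
               \<and> ham N (- \<epsilon>) (psi N m e (2 * pi * real j / real N))
                   = (\<lambda>Y. EN N es (2 * pi * real j / real N) * psi N m e (2 * pi * real j / real N) Y))
        \<and> (\<forall>v lam. in_sector N m v \<and> v \<noteq> (\<lambda>_. 0) \<and> ham N (- \<epsilon>) v = (\<lambda>Y. lam * v Y)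
               \<and> (\<forall>j<N. (\<Sum>Y\<in>Pow {0..<N}. cnj (psi N m e (2 * pi * real j / real N) Y) * v Y) = 0)
               \<longrightarrow> (\<forall>j<N. Re (EN N es (2 * pi * real j / real N)) \<le> Re lam)))
    \<and> (\<exists>d::int \<Rightarrow> complex.
          (\<lambda>s. norm (d s)) summable_on UNIV
        \<and> (\<forall>s. s \<noteq> 0 \<longrightarrow> norm (d s) \<le> C * \<bar>\<epsilon>\<bar> ^ m)
        \<and> (\<forall>es e. (\<forall>N. m < N \<longrightarrow> is_fp N m \<epsilon> (es N) (e N) \<and> fp_norm N m K \<epsilon> (es N) (e N) \<le> B)
             \<longrightarrow> (\<forall>k::real. (\<lambda>N. EN N (es N) k) \<longlonglongrightarrow>
                    4 + infsum (\<lambda>s. d s * exp (\<i> * of_real k * of_int s)) UNIV))))))"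
  (is "\<forall>m. m > 0 \<longrightarrow> (\<exists>K. K > 0 \<and> (\<exists>B. B > 0 \<and> (\<exists>C. \<forall>\<epsilon>. K * \<bar>\<epsilon>\<bar> < 1 \<longrightarrow> ?P m K B C \<epsilon>)))")
proof (intro allI impI)
  fix m :: nat assume m: "m > 0"
  let ?K = "12 + 4 * real m"
  have K: "?K > 0" by simp
  \<comment> \<open>The radius \<open>B = 1\<close> is that of the ball on which the map contracts,
    and \<open>C = K ^ m\<close> arises from splitting the power in
    \<open>(K * \<bar>\<epsilon>\<bar>) ^ m\<close>.\<close>
  have "?P m ?K 1 (?K ^ m) \<epsilon>" if "?K * \<bar>\<epsilon>\<bar> < 1" for \<epsilon>
  proof -
    interpret droplet m \<epsilon> using m that by unfold_locales
    show ?thesis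
    proof (intro conjI)
      show "\<forall>N. m < N \<longrightarrow> (\<exists>es e. is_fp N m \<epsilon> es e \<and> fp_norm N m ?K \<epsilon> es e \<le> 1)"
        using fp_existence by blast
    next
      fix N es e
      show "\<exists>d::int \<Rightarrow> complex. (\<lambda>s. norm (d s)) summable_on UNIV
          \<and> (\<forall>s. s \<noteq> 0 \<longrightarrow> norm (d s) \<le> ?K ^ m * \<bar>\<epsilon>\<bar> ^ m)
          \<and> (\<forall>es e. (\<forall>N. m < N \<longrightarrow> is_fp N m \<epsilon> (es N) (e N) \<and> fp_norm N m ?K \<epsilon> (es N) (e N) \<le> 1)
             \<longrightarrow> (\<forall>k::real. (\<lambda>N. EN N (es N) k) \<longlonglongrightarrow>
                    4 + infsum (\<lambda>s. d s * exp (\<i> * of_real k * of_int s)) UNIV))"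
        by (rule infinite_volume_limit)
    qed (use spectral_gap chain.psi_eigenstate[OF chain] chain.is_fp_iff[OF chain] in \<open>auto\<close>)
  qed
  then show "\<exists>K. K > 0 \<and> (\<exists>B. B > 0 \<and> (\<exists>C. \<forall>\<epsilon>. K * \<bar>\<epsilon>\<bar> < 1 \<longrightarrow> ?P m K B C \<epsilon>))"
    by - (rule exI[of _ ?K], rule conjI[OF K], rule exI[of _ 1], rule conjI[OF zero_less_one],
      rule exI[of _ "?K ^ m"], blast)
qed

end
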